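(* For every $\delta>0$ and $M\in\mathbb{N}$ there exist $N_0$ and $c_0>0$ such that for every $N\ge N_0$ the following holds. Let $A\subseteq[N]$ with $|A|\ge\delta N$, and let $B$ be an $M$-homogeneous set of positive integers. Then there are at least $c_0N^{5/2}$ tuples $(x_1,x_2,y_1,y_2,y_3)\in A^2\times B^3$ satisfying $$x_1-x_2=y_1^2+y_2^2+y_3^2.$$
   Context: $[N]=\{1,\dots,\lfloor N\rfloor\}$. For $q\in\mathbb{N}$, $q\cdot[M]=\{q,2q,\dots,Mq\}$. A set $B$ of positive integers is $M$-homogeneous if $B\cap q\cdot[M]\neq\emptyset$ for every $q\in\mathbb{N}$. *)

theory Defs
  imports Complex_Main
begin

definition initial_segment :: "real \<Rightarrow> int set" where
  "initial_segment N = {1..\<lfloor>N\<rfloor>}"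

(* The scalar q ranges over positive integers only: no set of positive integers
   meets 0 * [M] = {0}. *)
definition homogeneous :: "nat \<Rightarrow> int set \<Rightarrow> bool" where
  "homogeneous M B \<longleftrightarrow>
     B \<subseteq> {0<..} \<and> (\<forall>q::int. q \<ge> 1 \<longrightarrow> B \<inter> (*) q ` initial_segment (real M) \<noteq> {})"

end

theory Submission
  imports Defs "HOL-Analysis.Kronecker_Approximation_Theorem"
begin

text \<open>
  Let \<open>n = \<lfloor>N\<rfloor>\<close>. The solutions are counted by Fourier analysis modulo \<open>4 n\<close>, a modulus large enough
  to turn congruences into equations. For the finitely many frequencies \<open>a\<close> at which the Fourier
  transform of \<open>A\<close> exceeds \<open>\<epsilon> n\<close>, quadratic recurrence and homogeneity give a set \<open>G\<close> of at least
  \<open>c(\<epsilon>) N\<^sup>1\<^sup>/\<^sup>2\<close> elements \<open>y\<close> of \<open>B\<close> for which \<open>y\<^sup>2 a / (4 n)\<close> is close to an integer, so that these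
  frequencies contribute nonnegatively, while \<open>a = 0\<close> gives a main term of the right order. The
  frequencies below \<open>\<epsilon>' n\<close> are handled by Cauchy-Schwarz and the bound \<open>O(Y\<^sup>4)\<close> for the number of
  solutions of \<open>y\<^sub>1\<^sup>2 + y\<^sub>2\<^sup>2 + y\<^sub>3\<^sup>2 = z\<^sub>1\<^sup>2 + z\<^sub>2\<^sup>2 + z\<^sub>3\<^sup>2\<close> in \<open>[Y]\<close>; this needs \<open>\<epsilon>'\<close> small in terms of
  \<open>c(\<epsilon>)\<close>. The range between \<open>\<epsilon>' n\<close> and \<open>\<epsilon> n\<close> is made negligible by pigeonholing the energy of \<open>A\<close>
  over a decreasing sequence of thresholds.
\<close>

section \<open>Quadratic recurrence in homogeneous sets\<close>

text \<open>The strict inequality makes the set of admissible points open, as the compactness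
  argument for uniform recurrence requires.\<close>

definition near_int :: "real \<Rightarrow> real \<Rightarrow> bool" where
  "near_int e x \<longleftrightarrow> (\<exists>k::int. \<bar>x - of_int k\<bar> < e)"

lemma near_int_mono: "near_int e x \<Longrightarrow> e \<le> f \<Longrightarrow> near_int f x"
  unfolding near_int_def by (blast intro: order_less_le_trans)

lemma near_int_add:
  assumes "near_int e x" "near_int f y"
  shows "near_int (e + f) (x + y)"
proof -
  from assms obtain k l :: int where "\<bar>x - of_int k\<bar> < e" "\<bar>y - of_int l\<bar> < f"
    unfolding near_int_def by blast
  then have "\<bar>x + y - of_int (k + l)\<bar> < e + f"
    by simp
  then show ?thesis
    unfolding near_int_def by blast
qed

lemma near_int_mult:
  assumes "near_int e x" "c \<ge> 1"
  shows "near_int (real c * e) (real c * x)"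
proof -
  from assms obtain k :: int where "\<bar>x - of_int k\<bar> < e"
    unfolding near_int_def by blast
  with assms have "real c * \<bar>x - of_int k\<bar> < real c * e"
    by simp
  then have "\<bar>real c * x - of_int (int c * k)\<bar> < real c * e"
    by (simp add: abs_mult flip: right_diff_distrib)
  then show ?thesis
    unfolding near_int_def by blast
qed

lemma near_int_shift:
  assumes "near_int e x" "x - y = of_int m"
  shows "near_int e y"
proof -
  from assms obtain k :: int where "\<bar>x - of_int k\<bar> < e"
    unfolding near_int_def by blast
  then have "\<bar>y - of_int (k - m)\<bar> < e"
    using assms(2) by simp
  then show ?thesis
    unfolding near_int_def by blast
qed

lemma open_near_int: "open {x. near_int e (c * x)}"
proof -
  have "{x. near_int e (c * x)} = (\<Union>k::int. {x. \<bar>c * x - of_int k\<bar> < e})"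
    by (auto simp: near_int_def)
  moreover have "open {x. \<bar>c * x - of_int k\<bar> < e}" for k :: int
    by (intro open_Collect_less continuous_intros)
  ultimately show ?thesis
    by auto
qed

lemma Dirichlet_near_int:
  assumes "e > 0"
  shows "\<exists>q\<ge>1. near_int e (real q * \<alpha>)"
proof -
  obtain n :: nat where n: "1 / real n < e" "n > 0"
    using assms by (metis gr_zeroI inverse_eq_divide real_arch_inverse)
  obtain h k where "0 < k" "\<bar>of_int k * \<alpha> - of_int h\<bar> < 1 / real n"
    using Dirichlet_approx[OF n(2), of \<alpha>] by metis
  with n have "nat k \<ge> 1" "\<bar>real (nat k) * \<alpha> - of_int h\<bar> < e"
    by auto
  then show ?thesis
    unfolding near_int_def by blast
qed

text \<open>Take \<open>s\<^sub>k\<close> with \<open>s\<^sub>k \<alpha>\<close> tending to \<open>0\<close> and \<open>s\<^sub>k\<^sup>2 \<alpha>\<close> tending to some \<open>\<gamma>\<close> modulo one. A sum \<open>q\<close> of \<open>D\<close>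
  successively chosen \<open>s\<^sub>k\<close> has \<open>q\<^sup>2 \<alpha>\<close> close to \<open>D \<gamma>\<close>, because the cross terms are negligible;
  finally \<open>D\<close> is chosen by Dirichlet's theorem.\<close>

lemma quadratic_recurrence:
  fixes \<alpha> e :: real
  assumes "e > 0"
  shows "\<exists>q\<ge>1. near_int e ((real q)\<^sup>2 * \<alpha>)"
proof -
  have "\<forall>k. \<exists>s\<ge>1. near_int (1 / real (Suc k)) (real s * \<alpha>)"
    by (intro allI Dirichlet_near_int) simp
  then obtain s where s: "\<And>k. s k \<ge> 1" "\<And>k. near_int (1 / real (Suc k)) (real (s k) * \<alpha>)"
    by metis
  have "compact {0..1::real}"
    by simp
  moreover have "\<forall>k. frac ((real (s k))\<^sup>2 * \<alpha>) \<in> {0..1}"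
    by (auto simp: frac_lt_1 less_imp_le)
  ultimately obtain \<gamma> r where r: "strict_mono (r :: nat \<Rightarrow> nat)"
      and lim: "((\<lambda>k. frac ((real (s k))\<^sup>2 * \<alpha>)) \<circ> r) \<longlonglongrightarrow> \<gamma>"
    unfolding compact_def by meson
  have close: "\<exists>s\<ge>1. near_int d (real s * \<alpha>) \<and> near_int d ((real s)\<^sup>2 * \<alpha> - \<gamma>)" if "d > 0" for d
  proof -
    obtain k0 where k0: "\<And>k. k \<ge> k0 \<Longrightarrow> \<bar>frac ((real (s (r k)))\<^sup>2 * \<alpha>) - \<gamma>\<bar> < d"
      using LIMSEQ_D[OF lim \<open>d > 0\<close>] by auto
    obtain k1 :: nat where k1: "1 / real (Suc k1) < d"
      using \<open>d > 0\<close> by (metis nat_approx_posE)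
    define k where "k = max k0 k1"
    have "1 / real (Suc (r k)) \<le> 1 / real (Suc k1)"
      using seq_suble[OF r, of k] by (intro divide_left_mono) (auto simp: k_def)
    then have "near_int d (real (s (r k)) * \<alpha>)"
      using near_int_mono[OF s(2)] k1 by force
    moreover have "near_int d ((real (s (r k)))\<^sup>2 * \<alpha> - \<gamma>)"
      using k0[of k] unfolding near_int_def
      by (intro exI[of _ "\<lfloor>(real (s (r k)))\<^sup>2 * \<alpha>\<rfloor>"]) (simp add: k_def frac_def algebra_simps)
    ultimately show ?thesis
      using s(1) by blast
  qed
  obtain D where D: "D \<ge> 1" "near_int (e / 2) (real D * \<gamma>)"
    using Dirichlet_near_int[of "e / 2" \<gamma>] assms by auto
  \<comment> \<open>The induction below accumulates \<open>D + 1\<close> errors of size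
    \<open>d\<close>, in total \<open>e / 2\<close>; the other half of \<open>e\<close> is spent on
    \<open>D * \<gamma>\<close>.\<close>
  define d where "d = e / (2 * real (Suc D))"
  have d: "d > 0"
    using assms by (simp add: d_def)
  \<comment> \<open>The clause \<open>q \<ge> j\<close> ensures that the final \<open>q\<close> is
    positive, since \<open>D \<ge> 1\<close>. The empty sum \<open>q = 0\<close> starts the
    induction, with one \<open>d\<close> to spare because the inequality is strict.\<close>
  have "\<exists>q\<ge>j. near_int (real (Suc j) * d) ((real q)\<^sup>2 * \<alpha> - real j * \<gamma>)" for j
  proof (induction j)
    case 0
    have "near_int d 0"
      unfolding near_int_def using d by (intro exI[of _ 0]) simp
    then show ?case
      by (intro exI[of _ 0]) auto
  next
    case (Suc j)
    then obtain q where q: "q \<ge> j" "near_int (real (Suc j) * d) ((real q)\<^sup>2 * \<alpha> - real j * \<gamma>)"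
      by blast
    \<comment> \<open>The tolerance for the new summand \<open>t\<close> is fixed after
      \<open>q\<close>, because the cross term \<open>2 q t \<alpha>\<close> multiplies the error of
      \<open>t \<alpha>\<close> by \<open>2 q\<close>. The denominator makes the square and the
      cross term cost exactly \<open>d\<close> together; \<open>Suc q\<close> instead of
      \<open>q\<close> keeps the cross-term tolerance positive when \<open>q = 0\<close>.\<close>
    define d' where "d' = d / (2 * real (Suc q) + 1)"
    have d': "d' > 0"
      using d by (simp add: d'_def)
    obtain t where t: "t \<ge> 1" "near_int d' (real t * \<alpha>)" "near_int d' ((real t)\<^sup>2 * \<alpha> - \<gamma>)"
      using close[OF d'] by blast
    have cross: "near_int (2 * real (Suc q) * d') (2 * real q * (real t * \<alpha>))"
    proof (cases "q = 0")
      case True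
      with d' show ?thesis
        unfolding near_int_def by (intro exI[of _ 0]) simp
    next
      case False
      then have "near_int (real (2 * q) * d') (real (2 * q) * (real t * \<alpha>))"
        using t(2) by (intro near_int_mult) auto
      then show ?thesis
        using d' by (auto simp: mult_ac algebra_simps intro: near_int_mono)
    qed
    have "near_int (real (Suc j) * d + (d' + 2 * real (Suc q) * d'))
        (((real q)\<^sup>2 * \<alpha> - real j * \<gamma>) + (((real t)\<^sup>2 * \<alpha> - \<gamma>) + 2 * real q * (real t * \<alpha>)))"
      by (intro near_int_add q t cross)
    moreover have "d' + 2 * real (Suc q) * d' = d"
    proof -
      have "d' * (2 * real (Suc q) + 1) = d"
        unfolding d'_def by simp
      then show ?thesis
        by (simp add: algebra_simps)
    qed
    ultimately have "near_int (real (Suc (Suc j)) * d) ((real (q + t))\<^sup>2 * \<alpha> - real (Suc j) * \<gamma>)"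
      by (simp add: algebra_simps power2_eq_square)
    with q(1) t(1) show ?case
      by (intro exI[of _ "q + t"]) auto
  qed
  then obtain q where q: "q \<ge> D" "near_int (real (Suc D) * d) ((real q)\<^sup>2 * \<alpha> - real D * \<gamma>)"
    by blast
  have "near_int (real (Suc D) * d + e / 2) (((real q)\<^sup>2 * \<alpha> - real D * \<gamma>) + real D * \<gamma>)"
    by (intro near_int_add q D)
  moreover have "real (Suc D) * d + e / 2 = e"
    unfolding d_def by (simp add: field_simps)
  ultimately show ?thesis
    using q(1) D(1) by (intro exI[of _ q]) auto
qed

text \<open>Compactness: the open sets \<open>U q\<close> cover the unit interval, so finitely many
  of them suffice. Passing to the fractional part of \<open>\<alpha>\<close> changes
  \<open>q^2 \<alpha>\<close> by an integer only.\<close>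

lemma quadratic_recurrence_uniform:
  fixes e :: real
  assumes "e > 0"
  shows "\<exists>L\<ge>1. \<forall>\<alpha>. \<exists>q\<in>{1..L}. near_int e ((real q)\<^sup>2 * \<alpha>)"
proof -
  define U where "U = (\<lambda>q. {\<alpha>. near_int e ((real q)\<^sup>2 * \<alpha>)})"
  have "{0..1} \<subseteq> (\<Union>q\<in>{1..}. U q)"
    using quadratic_recurrence[OF assms] by (auto simp: U_def)
  moreover have "\<And>q. q \<in> {1..} \<Longrightarrow> open (U q)"
    by (simp add: U_def open_near_int)
  ultimately obtain C where C: "C \<subseteq> {1..}" "finite C" "{0..1} \<subseteq> (\<Union>q\<in>C. U q)"
    using compactE_image[of "{0..1::real}" "{1..}" U] compact_Icc by metis
  define L where "L = Max (insert 1 C)"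
  have "\<exists>q\<in>{1..L}. near_int e ((real q)\<^sup>2 * \<alpha>)" for \<alpha>
  proof -
    have "frac \<alpha> \<in> {0..1}"
      by (simp add: frac_lt_1 less_imp_le)
    then obtain q where q: "q \<in> C" "near_int e ((real q)\<^sup>2 * frac \<alpha>)"
      using subsetD[OF C(3)] by (fastforce simp: U_def)
    have "near_int e ((real q)\<^sup>2 * \<alpha>)"
      by (rule near_int_shift[OF q(2), of _ "- (int q ^ 2 * \<lfloor>\<alpha>\<rfloor>)"]) (simp add: frac_def algebra_simps)
    moreover have "q \<in> {1..L}"
      using C q by (auto simp: L_def intro!: Max_ge)
    ultimately show ?thesis
      by blast
  qed
  moreover have "L \<ge> 1"
    using C(2) by (auto simp: L_def intro!: Max_ge)
  ultimately show ?thesis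
    by blast
qed

text \<open>Induction on the number of frequencies. A multiplier \<open>q0\<close> handles all but
  one frequency \<open>a\<close> with the smaller tolerance \<open>e / L1^2\<close>; a second
  multiplier \<open>q1 \<le> L1\<close> then handles \<open>q0^2 a\<close> and inflates the earlier
  errors by at most \<open>L1^2\<close>. Uniformity of \<open>L1\<close> allows it to be fixed
  before \<open>q0\<close>.\<close>

lemma simultaneous_quadratic_recurrence:
  fixes e :: real
  assumes "e > 0"
  shows "\<exists>L\<ge>1. \<forall>S. finite S \<longrightarrow> card S \<le> K \<longrightarrow> (\<exists>q\<in>{1..L}. \<forall>\<alpha>\<in>S. near_int e ((real q)\<^sup>2 * \<alpha>))"
  using assms
proof (induction K arbitrary: e)
  case 0
  show ?case
    by (intro exI[of _ 1]) auto
next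
  case (Suc K)
  obtain L1 where L1: "L1 \<ge> 1" "\<And>\<alpha>. \<exists>q\<in>{1..L1}. near_int e ((real q)\<^sup>2 * \<alpha>)"
    using quadratic_recurrence_uniform[OF \<open>e > 0\<close>] by blast
  have "e / (real L1)\<^sup>2 > 0"
    using \<open>e > 0\<close> L1(1) by simp
  from Suc.IH[OF this] obtain L0 where L0: "L0 \<ge> 1"
      "\<And>S. finite S \<Longrightarrow> card S \<le> K \<Longrightarrow> \<exists>q\<in>{1..L0}. \<forall>\<alpha>\<in>S. near_int (e / (real L1)\<^sup>2) ((real q)\<^sup>2 * \<alpha>)"
    by blast
  have "\<exists>q\<in>{1..L0 * L1}. \<forall>\<alpha>\<in>S. near_int e ((real q)\<^sup>2 * \<alpha>)" if S: "finite S" "card S \<le> Suc K" for S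
  proof (cases "S = {}")
    case True
    with L0 L1 show ?thesis
      by (intro bexI[of _ 1]) (auto simp: Suc_le_eq)
  next
    case False
    then obtain a where a: "a \<in> S"
      by blast
    have "card (S - {a}) \<le> K"
      using S a by simp
    then obtain q0 where q0: "q0 \<in> {1..L0}" "\<forall>\<alpha>\<in>S - {a}. near_int (e / (real L1)\<^sup>2) ((real q0)\<^sup>2 * \<alpha>)"
      using L0(2)[of "S - {a}"] S by auto
    obtain q1 where q1: "q1 \<in> {1..L1}" "near_int e ((real q1)\<^sup>2 * ((real q0)\<^sup>2 * a))"
      using L1(2) by blast
    have "near_int e ((real (q0 * q1))\<^sup>2 * \<alpha>)" if "\<alpha> \<in> S" for \<alpha>
    proof (cases "\<alpha> = a")
      case True
      with q1 show ?thesis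
        by (simp add: power_mult_distrib mult_ac)
    next
      case False
      with that q0 have "near_int (e / (real L1)\<^sup>2) ((real q0)\<^sup>2 * \<alpha>)"
        by blast
      then have "near_int (real (q1\<^sup>2) * (e / (real L1)\<^sup>2)) (real (q1\<^sup>2) * ((real q0)\<^sup>2 * \<alpha>))"
        by (rule near_int_mult) (use q1 in auto)
      moreover have "real (q1\<^sup>2) * (e / (real L1)\<^sup>2) \<le> e"
      proof -
        have "(real q1)\<^sup>2 \<le> (real L1)\<^sup>2"
          using q1(1) by (intro power_mono) auto
        then show ?thesis
          using \<open>e > 0\<close> L1(1) by (simp add: field_simps)
      qed
      ultimately show ?thesis
        by (auto simp: power_mult_distrib mult_ac dest: near_int_mono)
    qed
    moreover have "q0 * q1 \<in> {1..L0 * L1}"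
      using q0 q1 by (auto simp: Suc_le_eq intro: mult_le_mono)
    ultimately show ?thesis
      by blast
  qed
  moreover have "L0 * L1 \<ge> 1"
    using L0 L1 by (simp add: Suc_le_eq)
  ultimately show ?case
    by blast
qed

text \<open>Recurrence, applied to the dilates \<open>d\<^sup>2 S\<close>, and homogeneity turn each \<open>d\<close> into an element
  \<open>y = m q d\<close> of \<open>B\<close> with the required property; \<open>y\<close> arises from boundedly many \<open>d\<close>.\<close>

lemma homogeneous_recurrence:
  assumes "M \<ge> 1"
  shows "\<exists>L\<ge>1. \<forall>B S Y. homogeneous M B \<longrightarrow> finite S \<longrightarrow> card S \<le> K \<longrightarrow>
    Y div L \<le> L * card {y \<in> B. y \<le> int Y \<and> (\<forall>\<alpha>\<in>S. near_int (1 / 12) (of_int (y\<^sup>2) * \<alpha>))}"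
proof -
  \<comment> \<open>Homogeneity inserts a further factor \<open>k \<le> M\<close>, which multiplies
    errors by at most \<open>M^2\<close>. The target \<open>1 / 12\<close> is chosen so that three
    squares together have error below \<open>1 / 4\<close>.\<close>
  define e where "e = 1 / (12 * (real M)\<^sup>2)"
  have "e > 0"
    using assms by (simp add: e_def)
  from simultaneous_quadratic_recurrence[OF this, of K] obtain L0 where L0: "L0 \<ge> 1"
      "\<And>S. finite S \<Longrightarrow> card S \<le> K \<Longrightarrow> \<exists>q\<in>{1..L0}. \<forall>\<alpha>\<in>S. near_int e ((real q)\<^sup>2 * \<alpha>)"
    by blast
  define L where "L = M * L0"
  have L: "L \<ge> 1"
    using assms L0(1) by (simp add: L_def Suc_le_eq)
  have "Y div L \<le> L * card {y \<in> B. y \<le> int Y \<and> (\<forall>\<alpha>\<in>S. near_int (1 / 12) (of_int (y\<^sup>2) * \<alpha>))}"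
    if B: "homogeneous M B" and S: "finite S" "card S \<le> K" for B S Y
  proof -
    define G where "G = {y \<in> B. y \<le> int Y \<and> (\<forall>\<alpha>\<in>S. near_int (1 / 12) (of_int (y\<^sup>2) * \<alpha>))}"
    have "\<exists>l\<in>{1..L}. int (l * d) \<in> G" if d: "d \<in> {1..Y div L}" for d
    proof -
      have "finite ((*) ((real d)\<^sup>2) ` S)" "card ((*) ((real d)\<^sup>2) ` S) \<le> K"
        using S card_image_le[OF S(1), of "(*) ((real d)\<^sup>2)"] by auto
      from L0(2)[OF this] obtain q where
          q: "q \<in> {1..L0}" "\<forall>\<alpha>\<in>S. near_int e ((real q)\<^sup>2 * ((real d)\<^sup>2 * \<alpha>))"
        by (auto simp only: ball_simps)
      have "1 \<le> q" "1 \<le> d"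
        using d q(1) by (simp_all only: atLeastAtMost_iff)
      then have "1 \<le> q * d"
        using mult_le_mono[of 1 q 1 d] by simp
      then have "int (q * d) \<ge> 1"
        by linarith
      then have "B \<inter> (*) (int (q * d)) ` initial_segment (real M) \<noteq> {}"
        using B unfolding homogeneous_def by blast
      then obtain m where m: "m \<in> {1..int M}" "int (q * d) * m \<in> B"
        by (force simp: initial_segment_def)
      define k where "k = nat m"
      have k: "k \<in> {1..M}" "int (k * q * d) \<in> B"
        using m by (auto simp: k_def mult_ac)
      have l: "k * q \<in> {1..L}"
        using k(1) q(1) by (auto simp: L_def Suc_le_eq intro: mult_le_mono)
      have "k * q * d \<le> L * (Y div L)"
        using l d by (intro mult_le_mono) auto
      also have "\<dots> \<le> Y"
        by simp
      finally have "int (k * q * d) \<le> int Y"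
        by (simp only: of_nat_le_iff)
      moreover have "near_int (1 / 12) (of_int ((int (k * q * d))\<^sup>2) * \<alpha>)" if "\<alpha> \<in> S" for \<alpha>
      proof -
        have "near_int (real (k\<^sup>2) * e) (real (k\<^sup>2) * ((real q)\<^sup>2 * ((real d)\<^sup>2 * \<alpha>)))"
          using q(2) that k(1) by (intro near_int_mult) auto
        moreover have "real (k\<^sup>2) * e \<le> 1 / 12"
        proof -
          have "(real k)\<^sup>2 \<le> (real M)\<^sup>2"
            using k(1) by (intro power_mono) auto
          then show ?thesis
            using assms by (simp add: e_def field_simps)
        qed
        ultimately have "near_int (1 / 12) (real (k\<^sup>2) * ((real q)\<^sup>2 * ((real d)\<^sup>2 * \<alpha>)))"
          by (rule near_int_mono)
        then show ?thesis
          by (simp add: power_mult_distrib mult_ac)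
      qed
      ultimately show ?thesis
        using k(2) l by (intro bexI[of _ "k * q"]) (auto simp: G_def mult_ac)
    qed
    then obtain l where l: "\<And>d. d \<in> {1..Y div L} \<Longrightarrow> l d \<in> {1..L} \<and> int (l d * d) \<in> G"
      by metis
    have "G \<subseteq> {1..int Y}"
      using B by (auto simp: G_def homogeneous_def)
    then have G: "finite G"
      using finite_subset by blast
    \<comment> \<open>Since \<open>l d * d\<close> and \<open>l d\<close> determine
      \<open>d\<close>, each element of \<open>G\<close> arises from at most \<open>L\<close> values
      of \<open>d\<close>.\<close>
    have "card {1..Y div L} \<le> card ({1..L} \<times> G)"
    proof (rule card_inj_on_le[where f = "\<lambda>d. (l d, int (l d * d))"])
      show "inj_on (\<lambda>d. (l d, int (l d * d))) {1..Y div L}"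
      proof (rule inj_onI)
        fix d d' assume "d \<in> {1..Y div L}" and "(l d, int (l d * d)) = (l d', int (l d' * d'))"
        then show "d = d'"
          using l[of d] by (auto simp del: of_nat_mult)
      qed
    qed (use l G in auto)
    then show ?thesis
      by (simp add: card_cartesian_product G_def)
  qed
  with L show ?thesis
    by blast
qed

section \<open>Equal sums of three squares\<close>

lemma card_arith_progression_le:
  fixes m r x0 :: int
  assumes "1 \<le> m" "m \<le> r"
  shows "real (card {x \<in> {-r..r}. m dvd x - x0}) \<le> 4 * of_int r / of_int m"
proof -
  define lo hi where "lo = (- r - x0) div m" and "hi = (r - x0) div m"
  have "card {x \<in> {-r..r}. m dvd x - x0} \<le> card {lo..hi}"
  proof (rule card_inj_on_le[where f = "\<lambda>x. (x - x0) div m"])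
    show "inj_on (\<lambda>x. (x - x0) div m) {x \<in> {-r..r}. m dvd x - x0}"
      using assms by (intro inj_onI) (auto elim!: dvdE)
    show "(\<lambda>x. (x - x0) div m) ` {x \<in> {-r..r}. m dvd x - x0} \<subseteq> {lo..hi}"
      using assms by (auto simp: lo_def hi_def intro!: zdiv_mono1)
  qed auto
  also have "real (card {lo..hi}) \<le> 4 * of_int r / of_int m"
  proof -
    have "m * hi \<le> r - x0"
      using mult_div_mod_eq[of m "r - x0"] pos_mod_sign[of m "r - x0"] assms
      unfolding hi_def by linarith
    moreover have "m * lo > - r - x0 - m"
      using mult_div_mod_eq[of m "- r - x0"] pos_mod_bound[of m "- r - x0"] assms
      unfolding lo_def by linarith
    \<comment> \<open>Rounding costs at most \<open>2 m\<close> beyond the length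
      \<open>2 r\<close>, and \<open>m \<le> r\<close> absorbs this into \<open>4 r\<close>.\<close>
    ultimately have *: "m * (hi - lo + 1) \<le> 4 * r"
      using assms by (simp add: algebra_simps)
    have "lo \<le> hi"
      using assms unfolding lo_def hi_def by (intro zdiv_mono1) auto
    then have "real (card {lo..hi}) * of_int m = of_int (m * (hi - lo + 1))"
      by simp
    also have "\<dots> \<le> of_int (4 * r)"
      using * by (simp only: of_int_le_iff)
    finally show ?thesis
      using assms by (simp add: field_simps)
  qed
  finally show ?thesis
    by simp
qed

lemma dvd_mult_iff_div_gcd_dvd:
  fixes m k x :: int
  assumes "m \<noteq> 0"
  shows "m dvd k * x \<longleftrightarrow> m div gcd m k dvd x"
proof -
  define g where "g = gcd m k"
  have g: "g \<noteq> 0"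
    using assms by (simp add: g_def)
  have mk: "m = g * (m div g)" "k = g * (k div g)"
    by (simp_all add: g_def)
  have "coprime (m div g) (k div g)"
    using assms unfolding g_def by (intro div_gcd_coprime) auto
  then have "m div g dvd x \<longleftrightarrow> m div g dvd (k div g) * x"
    by (simp add: coprime_dvd_mult_right_iff)
  also have "\<dots> \<longleftrightarrow> g * (m div g) dvd g * ((k div g) * x)"
    using g by simp
  also have "\<dots> \<longleftrightarrow> m dvd k * x"
    using mk by (metis mult.assoc)
  finally show ?thesis
    by (simp add: g_def)
qed

text \<open>Solvability in \<open>y\<close> forces \<open>g = gcd c b\<close> to divide
  \<open>a x\<close>, so \<open>x\<close> runs over multiples of \<open>g div h\<close> with
  \<open>h = gcd g a\<close>. For fixed \<open>x\<close> the solutions \<open>y\<close> form one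
  residue class modulo \<open>c div g\<close>. The two counts multiply to the bound.\<close>

lemma card_linear_congruence_le:
  fixes a b c r :: int
  assumes "a \<in> {1..r}" "b \<in> {1..r}" "c \<in> {1..r}"
  shows "real (card {(x, y). x \<in> {-r..r} \<and> y \<in> {-r..r} \<and> c dvd a * x + b * y})
    \<le> 16 * (of_int r)\<^sup>2 * (of_int (gcd (gcd c b) a) / of_int c)"
proof -
  define g where "g = gcd c b"
  define h where "h = gcd g a"
  have pos: "g \<ge> 1" "h \<ge> 1"
    using assms by (auto simp: g_def h_def Suc_le_eq int_one_le_iff_zero_less)
  have gc: "c div g \<ge> 1" "c div g \<le> r" "g div h \<ge> 1" "g div h \<le> r"
  proof -
    have "g dvd c" "h dvd g"
      unfolding g_def h_def by (rule gcd_dvd1)+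
    then have "g * (c div g) = c" "h * (g div h) = g"
      by auto
    moreover have "c div g > 0" "g div h > 0"
      using assms pos \<open>g dvd c\<close> \<open>h dvd g\<close> by (auto simp: pos_imp_zdiv_pos_iff zdvd_imp_le)
    moreover have "x div y \<le> x" if "y dvd x" "x > 0" for x y :: int
      using that by (metis dvd_div_mult_self dvd_triv_left zdvd_imp_le)
    then have "c div g \<le> c" "g div h \<le> g"
      using assms pos \<open>g dvd c\<close> \<open>h dvd g\<close> by auto
    moreover have "g \<le> c"
      using assms \<open>g dvd c\<close> by (auto intro: zdvd_imp_le)
    ultimately show "c div g \<ge> 1" "c div g \<le> r" "g div h \<ge> 1" "g div h \<le> r"
      using assms by auto
  qed
  \<comment> \<open>The multiples are written as the progression through \<open>0\<close>, the form
    in which \<open>card_arith_progression_le\<close> counts them.\<close>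
  define X where "X = {x \<in> {-r..r}. g div h dvd x - 0}"
  define F where "F = (\<lambda>x. {y \<in> {-r..r}. c dvd a * x + b * y})"
  have "{(x, y). x \<in> {-r..r} \<and> y \<in> {-r..r} \<and> c dvd a * x + b * y} \<subseteq> Sigma X F"
  proof (rule subrelI)
    fix x y assume "(x, y) \<in> {(x, y). x \<in> {-r..r} \<and> y \<in> {-r..r} \<and> c dvd a * x + b * y}"
    then have *: "x \<in> {-r..r}" "y \<in> {-r..r}" "c dvd a * x + b * y"
      by auto
    then have "g dvd a * x + b * y"
      unfolding g_def using dvd_trans gcd_dvd1 by blast
    moreover have "g dvd b * y"
      by (simp add: g_def)
    ultimately have "g dvd a * x"
      by (simp add: dvd_add_left_iff)
    then have "g div h dvd x"
      using pos dvd_mult_iff_div_gcd_dvd[of g a x] by (simp add: h_def)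
    with * show "(x, y) \<in> Sigma X F"
      by (simp add: X_def F_def)
  qed
  moreover have fin: "finite X" "\<And>x. finite (F x)"
    unfolding X_def F_def by (rule finite_subset[of _ "{-r..r}"]; auto)+
  ultimately have "real (card {(x, y). x \<in> {-r..r} \<and> y \<in> {-r..r} \<and> c dvd a * x + b * y})
      \<le> real (card (Sigma X F))"
    by (intro of_nat_mono card_mono finite_SigmaI) auto
  also have "\<dots> = (\<Sum>x\<in>X. real (card (F x)))"
    using fin by (simp add: card_SigmaI)
  also have "\<dots> \<le> (\<Sum>x\<in>X. 4 * of_int r / of_int (c div g))"
  proof (rule sum_mono)
    fix x assume "x \<in> X"
    show "real (card (F x)) \<le> 4 * of_int r / of_int (c div g)"
    proof (cases "F x = {}")
      case True
      then show ?thesis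
        using assms gc by simp
    next
      case False
      then obtain y0 where y0: "c dvd a * x + b * y0"
        by (auto simp: F_def)
      have "F x \<subseteq> {y \<in> {-r..r}. c div g dvd y - y0}"
      proof clarify
        fix y assume "y \<in> F x"
        then have "c dvd (a * x + b * y) - (a * x + b * y0)"
          using y0 by (intro dvd_diff) (auto simp: F_def)
        then have "c dvd b * (y - y0)"
          by (simp add: algebra_simps)
        then show "y \<in> {-r..r} \<and> c div g dvd y - y0"
          using assms dvd_mult_iff_div_gcd_dvd[of c b "y - y0"] \<open>y \<in> F x\<close> by (simp add: g_def F_def)
      qed
      then have "real (card (F x)) \<le> real (card {y \<in> {-r..r}. c div g dvd y - y0})"
        by (intro of_nat_mono card_mono) (auto intro: finite_subset[of _ "{-r..r}"])
      also have "\<dots> \<le> 4 * of_int r / of_int (c div g)"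
        using gc by (intro card_arith_progression_le)
      finally show ?thesis .
    qed
  qed
  also have "\<dots> = real (card X) * (4 * of_int r / of_int (c div g))"
    by simp
  also have "\<dots> \<le> (4 * of_int r / of_int (g div h)) * (4 * of_int r / of_int (c div g))"
    unfolding X_def using gc assms by (intro mult_right_mono card_arith_progression_le) auto
  also have "\<dots> = 16 * (of_int r)\<^sup>2 * (of_int h / of_int c)"
  proof -
    have "h dvd g" "g dvd c"
      unfolding g_def h_def by (rule gcd_dvd1)+
    then have *: "of_int (g div h) = (of_int g / of_int h :: real)" "of_int (c div g) = (of_int c / of_int g :: real)"
      by (simp_all add: real_of_int_div)
    show ?thesis
      unfolding * using pos by (simp add: field_simps power2_eq_square)
  qed
  finally show ?thesis
    by (simp add: g_def h_def)
qed

section \<open>Averages of greatest common divisors\<close>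

lemma card_multiples_le:
  fixes c d :: int
  assumes "1 \<le> d" "0 \<le> c"
  shows "real (card {a \<in> {1..c}. d dvd a}) \<le> of_int c / of_int d"
proof -
  have "card {a \<in> {1..c}. d dvd a} \<le> card {1..c div d}"
  proof (rule card_inj_on_le[where f = "\<lambda>x. x div d"])
    show "inj_on (\<lambda>x. x div d) {a \<in> {1..c}. d dvd a}"
      using assms by (intro inj_onI) (auto elim!: dvdE)
    show "(\<lambda>x. x div d) ` {a \<in> {1..c}. d dvd a} \<subseteq> {1..c div d}"
      using assms by (auto intro: zdiv_mono1 simp: zdvd_imp_le int_one_le_iff_zero_less pos_imp_zdiv_pos_iff)
  qed auto
  also have "real (card {1..c div d}) \<le> of_int c / of_int d"
  proof -
    have "real (card {1..c div d}) = of_int (c div d)"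
      using assms by (simp add: pos_imp_zdiv_nonneg_iff)
    also have "\<dots> \<le> of_int c / of_int d"
      by (rule real_of_int_div4)
    finally show ?thesis .
  qed
  finally show ?thesis
    by simp
qed

text \<open>The term \<open>- 1 / real (Suc n)\<close> makes the induction telescope, because
  \<open>1 / k^2 \<le> 1 / (k - 1) - 1 / k\<close>.\<close>

lemma sum_inverse_squares_le:
  "(\<Sum>d\<in>{1..int (Suc n)}. 1 / (of_int d)\<^sup>2) \<le> (2 - 1 / real (Suc n) :: real)"
proof (induction n)
  case (Suc n)
  have "{1..int (Suc (Suc n))} = insert (int (Suc (Suc n))) {1..int (Suc n)}"
    by auto
  then have "(\<Sum>d\<in>{1..int (Suc (Suc n))}. 1 / (of_int d)\<^sup>2 :: real)
      = 1 / (real (Suc (Suc n)))\<^sup>2 + (\<Sum>d\<in>{1..int (Suc n)}. 1 / (of_int d)\<^sup>2)"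
    by simp
  also have "\<dots> \<le> 1 / (real (Suc (Suc n)))\<^sup>2 + (2 - 1 / real (Suc n))"
    using Suc.IH by simp
  also have "\<dots> \<le> 2 - 1 / real (Suc (Suc n))"
    by (simp add: divide_simps power2_eq_square) (simp add: algebra_simps)
  finally show ?case .
qed simp

text \<open>The gcd is at most the sum of all common divisors \<open>d\<close> of \<open>a\<close>,
  \<open>b\<close> and \<open>c\<close>. After exchanging the sums, a divisor \<open>d\<close> of
  \<open>c\<close> has at most \<open>(c / d)^2\<close> pairs and so contributes at most
  \<open>c / d \<le> r / d\<close>. At most \<open>r / d\<close> values of \<open>c\<close> are
  multiples of \<open>d\<close>, which leaves \<open>r^2\<close> times the sum of
  \<open>1 / d^2\<close>.\<close>

lemma sum_gcd_le:
  fixes r :: int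
  assumes "r \<ge> 1"
  shows "(\<Sum>c\<in>{1..r}. \<Sum>(a, b)\<in>{1..c} \<times> {1..c}. of_int (gcd (gcd c b) a) / of_int c)
    \<le> (2 * (of_int r)\<^sup>2 :: real)"
proof -
  have "(\<Sum>(a, b)\<in>{1..c} \<times> {1..c}. of_int (gcd (gcd c b) a) / of_int c)
      \<le> (\<Sum>d\<in>{1..r}. of_bool (d dvd c) * (of_int r / of_int d) :: real)" if c: "c \<in> {1..r}" for c
  proof -
    have "(\<Sum>(a, b)\<in>{1..c} \<times> {1..c}. of_int (gcd (gcd c b) a) / of_int c)
      \<le> (\<Sum>(a, b)\<in>{1..c} \<times> {1..c}. \<Sum>d\<in>{1..r}.
            of_bool (d dvd c) * of_bool (d dvd a) * of_bool (d dvd b) * (of_int d / of_int c) :: real)"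
    proof (rule sum_mono, clarify)
      fix a b assume "a \<in> {1..c}" "b \<in> {1..c}"
      define h where "h = gcd (gcd c b) a"
      have "h > 0" "h dvd c" "h dvd a" "h dvd b"
        using c by (auto simp: h_def intro: dvd_trans[OF gcd_dvd1])
      moreover from this have "h \<in> {1..r}"
        using c zdvd_imp_le[of h c] by auto
      ultimately have "of_int h / of_int c = (\<Sum>d\<in>{h}.
          of_bool (d dvd c) * of_bool (d dvd a) * of_bool (d dvd b) * (of_int d / of_int c) :: real)"
        by simp
      also have "\<dots> \<le> (\<Sum>d\<in>{1..r}.
          of_bool (d dvd c) * of_bool (d dvd a) * of_bool (d dvd b) * (of_int d / of_int c) :: real)"
        using \<open>h \<in> {1..r}\<close> c by (intro sum_mono2) auto
      finally show "of_int (gcd (gcd c b) a) / of_int c \<le> (\<Sum>d\<in>{1..r}.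
          of_bool (d dvd c) * of_bool (d dvd a) * of_bool (d dvd b) * (of_int d / of_int c) :: real)"
        by (simp add: h_def)
    qed
    also have "\<dots> = (\<Sum>d\<in>{1..r}. \<Sum>(a, b)\<in>{1..c} \<times> {1..c}.
            of_bool (d dvd c) * of_bool (d dvd a) * of_bool (d dvd b) * (of_int d / of_int c))"
      by (subst sum.swap) (simp add: case_prod_unfold)
    also have "\<dots> \<le> (\<Sum>d\<in>{1..r}. of_bool (d dvd c) * (of_int r / of_int d))"
    proof (rule sum_mono)
      fix d assume d: "d \<in> {1..r}"
      define m :: real where "m = (\<Sum>a\<in>{1..c}. of_bool (d dvd a))"
      have "m = real (card {a \<in> {1..c}. d dvd a})"
        by (simp add: m_def Int_def of_bool_def sum.If_cases)
      then have m: "0 \<le> m" "m \<le> of_int c / of_int d"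
        using card_multiples_le[of d c] c d by auto
      have mm: "m * m = (\<Sum>(a, b)\<in>{1..c} \<times> {1..c}. of_bool (d dvd a) * of_bool (d dvd b))"
        by (simp only: m_def sum_product sum.cartesian_product)
      have "(\<Sum>(a, b)\<in>{1..c} \<times> {1..c}.
          of_bool (d dvd c) * of_bool (d dvd a) * of_bool (d dvd b) * (of_int d / of_int c))
          = of_bool (d dvd c) * (of_int d / of_int c) * (m * m)"
        unfolding mm sum_distrib_left by (intro sum.cong) auto
      also have "\<dots> \<le> of_bool (d dvd c) * (of_int d / of_int c) * ((of_int c / of_int d) * (of_int c / of_int d))"
        using m c d by (intro mult_left_mono mult_mono) auto
      also have "\<dots> = of_bool (d dvd c) * (of_int c / of_int d)"
        using c d by (simp add: field_simps)
      also have "\<dots> \<le> of_bool (d dvd c) * (of_int r / of_int d)"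
        using c d by (intro mult_left_mono divide_right_mono) auto
      finally show "(\<Sum>(a, b)\<in>{1..c} \<times> {1..c}.
          of_bool (d dvd c) * of_bool (d dvd a) * of_bool (d dvd b) * (of_int d / of_int c))
          \<le> of_bool (d dvd c) * (of_int r / of_int d :: real)" .
    qed
    finally show ?thesis .
  qed
  then have "(\<Sum>c\<in>{1..r}. \<Sum>(a, b)\<in>{1..c} \<times> {1..c}. of_int (gcd (gcd c b) a) / of_int c :: real)
      \<le> (\<Sum>c\<in>{1..r}. \<Sum>d\<in>{1..r}. of_bool (d dvd c) * (of_int r / of_int d))"
    by (rule sum_mono)
  also have "\<dots> = (\<Sum>d\<in>{1..r}. real (card {c \<in> {1..r}. d dvd c}) * (of_int r / of_int d))"
  proof (subst sum.swap, rule sum.cong[OF refl])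
    fix d
    have "(\<Sum>c\<in>{1..r}. of_bool (d dvd c)) = real (card {c \<in> {1..r}. d dvd c})"
      by (simp add: Int_def of_bool_def sum.If_cases)
    then show "(\<Sum>c\<in>{1..r}. of_bool (d dvd c) * (of_int r / of_int d))
        = real (card {c \<in> {1..r}. d dvd c}) * (of_int r / of_int d)"
      by (simp only: flip: sum_distrib_right)
  qed
  also have "\<dots> \<le> (\<Sum>d\<in>{1..r}. (of_int r / of_int d) * (of_int r / of_int d))"
    using assms by (intro sum_mono mult_right_mono card_multiples_le) auto
  also have "\<dots> = (of_int r)\<^sup>2 * (\<Sum>d\<in>{1..r}. 1 / (of_int d)\<^sup>2)"
    by (simp add: sum_distrib_left power2_eq_square)
  also have "\<dots> \<le> (of_int r)\<^sup>2 * 2"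
  proof (rule mult_left_mono)
    obtain n where n: "r = int (Suc n)"
      using assms by (metis int_one_le_iff_zero_less zero_less_imp_eq_int gr0_implies_Suc)
    have "(2 - 1 / real (Suc n)) \<le> 2"
      by simp
    then show "(\<Sum>d\<in>{1..r}. 1 / (of_int d)\<^sup>2) \<le> (2 :: real)"
      using sum_inverse_squares_le[of n] unfolding n by linarith
  qed simp
  finally show ?thesis
    by simp
qed

text \<open>As \<open>v3\<close> is positive, \<open>u3\<close> is determined by the other
  coordinates, and what remains is a congruence modulo \<open>v3\<close> in \<open>u1\<close> and
  \<open>u2\<close>. Summing the congruence bound over the coefficients gives the gcd average;
  keeping \<open>v1\<close> and \<open>v2\<close> at most \<open>v3\<close> prevents the loss of a
  logarithm there.\<close>

lemma card_orthogonal_max_last_le: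
  fixes r :: int
  assumes "r \<ge> 1"
  defines "Z \<equiv> {(u1, u2, u3, v1, v2, v3).
    u1 \<in> {-r..r} \<and> u2 \<in> {-r..r} \<and> u3 \<in> {-r..r} \<and> v1 \<in> {1..v3} \<and> v2 \<in> {1..v3} \<and> v3 \<in> {1..r} \<and>
    v1 * u1 + v2 * u2 + v3 * u3 = 0}"
  shows "finite Z" "real (card Z) \<le> 32 * (of_int r) ^ 4"
proof -
  have "Z \<subseteq> {-r..r} \<times> {-r..r} \<times> {-r..r} \<times> {1..r} \<times> {1..r} \<times> {1..r}"
    by (auto simp: Z_def)
  then show "finite Z"
    by (rule finite_subset) auto
  define F where "F = (\<lambda>c (a, b). {(x, y). x \<in> {-r..r} \<and> y \<in> {-r..r} \<and> c dvd a * x + b * y})"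
  have F: "finite (F c p)" for c p
  proof -
    have "F c p \<subseteq> {-r..r} \<times> {-r..r}"
      by (auto simp: F_def split: prod.splits)
    then show ?thesis
      by (rule finite_subset) auto
  qed
  define W where "W = (SIGMA c:{1..r}. SIGMA p:{1..c} \<times> {1..c}. F c p)"
  have ZW: "card Z \<le> card W"
  proof (rule card_inj_on_le[where f = "\<lambda>(u1, u2, u3, v1, v2, v3). (v3, (v1, v2), (u1, u2))"])
    show "inj_on (\<lambda>(u1, u2, u3, v1, v2, v3). (v3, (v1, v2), (u1, u2))) Z"
    proof -
      have "u3 = u3'" if "v1 * u1 + v2 * u2 + v3 * u3 = 0" "v1 * u1 + v2 * u2 + v3 * u3' = 0" "1 \<le> v3"
        for u1 u2 u3 u3' v1 v2 v3 :: int
      proof -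
        have "v3 * u3 = v3 * u3'"
          using that by linarith
        with that show ?thesis
          by simp
      qed
      then show ?thesis
        unfolding inj_on_def Z_def by fastforce
    qed
    have "v3 dvd v1 * u1 + v2 * u2" if "v1 * u1 + v2 * u2 + v3 * u3 = 0" for u1 u2 u3 v1 v2 v3 :: int
      using that by (intro dvdI[of _ _ "- u3"]) (simp add: algebra_simps)
    then show "(\<lambda>(u1, u2, u3, v1, v2, v3). (v3, (v1, v2), (u1, u2))) ` Z \<subseteq> W"
      by (auto simp: Z_def W_def F_def)
    show "finite W"
      using F by (auto simp: W_def intro!: finite_SigmaI)
  qed
  have "card W = (\<Sum>c\<in>{1..r}. \<Sum>p\<in>{1..c} \<times> {1..c}. card (F c p))"
    using F by (simp add: W_def card_SigmaI finite_SigmaI)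
  with ZW have "real (card Z) \<le> real (\<Sum>c\<in>{1..r}. \<Sum>p\<in>{1..c} \<times> {1..c}. card (F c p))"
    by (simp only: of_nat_le_iff)
  also have "\<dots> = (\<Sum>c\<in>{1..r}. \<Sum>p\<in>{1..c} \<times> {1..c}. real (card (F c p)))"
    by simp
  also have "\<dots> \<le> (\<Sum>c\<in>{1..r}. \<Sum>(a, b)\<in>{1..c} \<times> {1..c}.
      16 * (of_int r)\<^sup>2 * (of_int (gcd (gcd c b) a) / of_int c))"
  proof (intro sum_mono, clarify)
    fix c a b :: int assume "c \<in> {1..r}" "a \<in> {1..c}" "b \<in> {1..c}"
    then show "real (card (F c (a, b))) \<le> 16 * (of_int r)\<^sup>2 * (of_int (gcd (gcd c b) a) / of_int c)"
      using card_linear_congruence_le[of a r b c] by (simp add: F_def)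
  qed
  also have "\<dots> = 16 * (of_int r)\<^sup>2 *
      (\<Sum>c\<in>{1..r}. \<Sum>(a, b)\<in>{1..c} \<times> {1..c}. of_int (gcd (gcd c b) a) / of_int c)"
    by (simp only: sum_distrib_left case_prod_unfold)
  also have "\<dots> \<le> 16 * (of_int r)\<^sup>2 * (2 * (of_int r)\<^sup>2)"
    by (intro mult_left_mono sum_gcd_le assms) auto
  also have "\<dots> = 32 * (of_int r) ^ 4"
    by (simp flip: power_add)
  finally show "real (card Z) \<le> 32 * (of_int r) ^ 4" .
qed

fun sum_sq :: "int \<times> int \<times> int \<Rightarrow> int" where
  "sum_sq (x, y, z) = x\<^sup>2 + y\<^sup>2 + z\<^sup>2"

text \<open>With \<open>u = y - z\<close> and \<open>v = y + z\<close>, the equation \<open>sum_sq y = sum_sq z\<close> says that \<open>u\<close> and \<open>v\<close> are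
  orthogonal; by symmetry the last coordinate of \<open>v\<close> may be taken to be the largest.\<close>

lemma card_sum_sq_eq_le:
  fixes n :: int
  assumes "n \<ge> 1"
  defines "X \<equiv> {1..n} \<times> {1..n} \<times> {1..n}"
  shows "real (card {(s, t) \<in> X \<times> X. sum_sq s = sum_sq t}) \<le> 1536 * (of_int n) ^ 4"
proof -
  define r where "r = 2 * n"
  have r: "r \<ge> 1"
    using assms by (simp add: r_def)
  define Z where "Z = {(u1, u2, u3, v1, v2, v3).
    u1 \<in> {-r..r} \<and> u2 \<in> {-r..r} \<and> u3 \<in> {-r..r} \<and> v1 \<in> {1..v3} \<and> v2 \<in> {1..v3} \<and> v3 \<in> {1..r} \<and>
    v1 * u1 + v2 * u2 + v3 * u3 = 0}"
  have Z: "finite Z" "real (card Z) \<le> 32 * (of_int r) ^ 4"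
    unfolding Z_def using card_orthogonal_max_last_le[OF r] by auto
  \<comment> \<open>These involutions exchange the third coordinates of both \<open>u\<close> and
    \<open>v\<close> with the first or the second ones.\<close>
  define f1 f2 :: "int \<times> int \<times> int \<times> int \<times> int \<times> int \<Rightarrow> _" where
    "f1 = (\<lambda>(u1, u2, u3, v1, v2, v3). (u3, u2, u1, v3, v2, v1))" and
    "f2 = (\<lambda>(u1, u2, u3, v1, v2, v3). (u1, u3, u2, v1, v3, v2))"
  define h :: "(int \<times> int \<times> int) \<times> (int \<times> int \<times> int) \<Rightarrow> _" where
    "h = (\<lambda>((y1, y2, y3), (z1, z2, z3)). (y1 - z1, y2 - z2, y3 - z3, y1 + z1, y2 + z2, y3 + z3))"
  have f: "f1 (f1 x) = x" "f2 (f2 x) = x" for x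
    by (auto simp: f1_def f2_def split: prod.splits)
  have "card {(s, t) \<in> X \<times> X. sum_sq s = sum_sq t} \<le> card (Z \<union> (f1 ` Z \<union> f2 ` Z))"
  proof (rule card_inj_on_le[where f = h])
    show "inj_on h {(s, t) \<in> X \<times> X. sum_sq s = sum_sq t}"
      by (rule inj_onI) (auto simp: h_def)
    show "h ` {(s, t) \<in> X \<times> X. sum_sq s = sum_sq t} \<subseteq> Z \<union> (f1 ` Z \<union> f2 ` Z)"
    proof
      fix w assume "w \<in> h ` {(s, t) \<in> X \<times> X. sum_sq s = sum_sq t}"
      then obtain y1 y2 y3 z1 z2 z3 where y: "{y1, y2, y3, z1, z2, z3} \<subseteq> {1..n}"
          "y1\<^sup>2 + y2\<^sup>2 + y3\<^sup>2 = z1\<^sup>2 + z2\<^sup>2 + z3\<^sup>2"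
          and w: "w = (y1 - z1, y2 - z2, y3 - z3, y1 + z1, y2 + z2, y3 + z3)"
        by (auto simp: X_def h_def)
      have "(y1 + z1) * (y1 - z1) + (y2 + z2) * (y2 - z2) + (y3 + z3) * (y3 - z3) = 0"
        using y(2) by (simp add: algebra_simps power2_eq_square)
      moreover have "(y1 + z1 \<le> y3 + z3 \<and> y2 + z2 \<le> y3 + z3) \<or>
          (y3 + z3 \<le> y1 + z1 \<and> y2 + z2 \<le> y1 + z1) \<or> (y1 + z1 \<le> y2 + z2 \<and> y3 + z3 \<le> y2 + z2)"
        by linarith
      ultimately have "w \<in> Z \<or> f1 w \<in> Z \<or> f2 w \<in> Z"
        using y(1) unfolding w f1_def f2_def Z_def r_def by (elim disjE) (auto simp: ac_simps)
      then show "w \<in> Z \<union> (f1 ` Z \<union> f2 ` Z)"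
        using f by (metis UnCI image_eqI)
    qed
  qed (use Z in auto)
  also have "\<dots> \<le> card Z + (card (f1 ` Z) + card (f2 ` Z))"
    using card_Un_le[of Z "f1 ` Z \<union> f2 ` Z"] card_Un_le[of "f1 ` Z" "f2 ` Z"] by linarith
  also have "\<dots> \<le> card Z + (card Z + card Z)"
    by (intro add_mono card_image_le Z order_refl)
  finally have "real (card {(s, t) \<in> X \<times> X. sum_sq s = sum_sq t}) \<le> 3 * real (card Z)"
    by linarith
  also have "\<dots> \<le> 3 * (32 * (of_int r) ^ 4)"
    using Z by simp
  \<comment> \<open>The constant is \<open>3 * 32 * 2^4\<close>: three positions of the maximum, and
    \<open>r = 2 * n\<close>.\<close>
  also have "\<dots> = 1536 * (of_int n) ^ 4"
    by (simp add: r_def power_mult_distrib)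
  finally show ?thesis .
qed

section \<open>Exponential sums modulo P\<close>

definition char_mod :: "nat \<Rightarrow> int \<Rightarrow> complex" where
  "char_mod P k = cis (2 * pi * of_int k / real P)"

lemma char_mod_add: "char_mod P (k + l) = char_mod P k * char_mod P l"
  by (simp add: char_mod_def cis_mult add_divide_distrib ring_distribs)

lemma cnj_char_mod: "cnj (char_mod P k) = char_mod P (- k)"
  by (simp add: char_mod_def cis_cnj)

lemma char_mod_0 [simp]: "char_mod P 0 = 1"
  by (simp add: char_mod_def)

lemma norm_char_mod [simp]: "norm (char_mod P k) = 1"
  by (simp add: char_mod_def)

lemma char_mod_multiple:
  assumes "P \<ge> 1"
  shows "char_mod P (int P * l) = 1"
proof -
  have "2 * pi * of_int (int P * l) / real P = 2 * pi * of_int l"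
    using assms by simp
  then show ?thesis
    unfolding char_mod_def by (simp only: cis_multiple_2pi Ints_of_int)
qed

lemma char_mod_power: "char_mod P (int a * k) = char_mod P k ^ a"
  by (induction a) (simp_all add: ring_distribs char_mod_add)

text \<open>If \<open>P\<close> does not divide \<open>k\<close>, then \<open>char_mod P k\<close>
  is a root of unity of order dividing \<open>P\<close> and different from 1, so its geometric sum
  vanishes.\<close>

lemma sum_char_mod:
  assumes "P \<ge> 1"
  shows "(\<Sum>a<P. char_mod P (int a * k)) = (if int P dvd k then of_nat P else 0)"
proof (cases "int P dvd k")
  case True
  then obtain l where "k = int P * l"
    by blast
  then have "char_mod P (int a * k) = 1" for a
    using char_mod_multiple[OF assms, of "int a * l"] by (simp add: mult.left_commute)
  with True show ?thesis
    by simp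
next
  case False
  define z where "z = char_mod P k"
  have "z \<noteq> 1"
  proof
    assume "z = 1"
    then have "cos (2 * pi * of_int k / real P) = 1"
      by (simp add: z_def char_mod_def complex_eq_iff)
    then obtain n :: int where "2 * pi * of_int k / real P = of_int n * 2 * pi"
      using cos_one_2pi_int by blast
    then have "real_of_int k = of_int (n * int P)"
      using assms by (simp add: field_simps)
    then have "k = n * int P"
      by (simp only: of_int_eq_iff)
    with False show False
      by simp
  qed
  moreover have "z ^ P = 1"
    using char_mod_multiple[OF assms] by (simp add: z_def flip: char_mod_power)
  ultimately show ?thesis
    using False by (simp add: char_mod_power z_def geometric_sum)
qed

text \<open>Allowing an arbitrary index set and phase function \<open>f\<close> makes products and
  conjugates of such sums again sums of this kind.\<close>

definition exp_sum :: "nat \<Rightarrow> ('a \<Rightarrow> int) \<Rightarrow> 'a set \<Rightarrow> nat \<Rightarrow> complex" where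
  "exp_sum P f X a = (\<Sum>x\<in>X. char_mod P (int a * f x))"

lemma exp_sum_0 [simp]: "exp_sum P f X 0 = of_nat (card X)"
  by (simp add: exp_sum_def)

lemma norm_exp_sum_le: "norm (exp_sum P f X a) \<le> real (card X)"
  unfolding exp_sum_def by (rule order_trans[OF norm_sum]) simp

lemma cnj_exp_sum: "cnj (exp_sum P f X a) = exp_sum P (\<lambda>x. - f x) X a"
  by (simp add: exp_sum_def cnj_char_mod)

lemma exp_sum_mult:
  "exp_sum P f X a * exp_sum P g Y a = exp_sum P (\<lambda>(x, y). f x + g y) (X \<times> Y) a"
proof -
  have "exp_sum P f X a * exp_sum P g Y a
      = (\<Sum>x\<in>X. \<Sum>y\<in>Y. char_mod P (int a * f x) * char_mod P (int a * g y))"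
    by (simp add: exp_sum_def sum_product)
  also have "\<dots> = (\<Sum>x\<in>X. \<Sum>y\<in>Y. char_mod P (int a * (f x + g y)))"
    by (simp add: char_mod_add distrib_left)
  finally show ?thesis
    by (simp add: exp_sum_def sum.cartesian_product case_prod_unfold)
qed

lemma sum_exp_sum:
  assumes "P \<ge> 1" "finite X"
  shows "(\<Sum>a<P. exp_sum P f X a) = of_nat (P * card {x \<in> X. int P dvd f x})"
proof -
  have "(\<Sum>a<P. exp_sum P f X a) = (\<Sum>x\<in>X. \<Sum>a<P. char_mod P (int a * f x))"
    unfolding exp_sum_def by (rule sum.swap)
  also have "\<dots> = (\<Sum>x\<in>X. if int P dvd f x then of_nat P else 0)"
    using assms by (simp add: sum_char_mod)
  also have "\<dots> = (\<Sum>x\<in>{x \<in> X. int P dvd f x}. of_nat P)"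
    by (simp only: sum.inter_filter[OF assms(2)])
  finally show ?thesis
    by (simp add: mult.commute)
qed

text \<open>The squared modulus is the exponential sum with phase \<open>f x - f y\<close> over
  \<open>X \<times> X\<close>, to which orthogonality applies.\<close>

lemma parseval_exp_sum:
  assumes "P \<ge> 1" "finite X"
  shows "(\<Sum>a<P. (norm (exp_sum P f X a))\<^sup>2) = real (P * card {(x, y) \<in> X \<times> X. int P dvd f x - f y})"
proof -
  have "complex_of_real (\<Sum>a<P. (norm (exp_sum P f X a))\<^sup>2)
      = (\<Sum>a<P. exp_sum P (\<lambda>(x, y). f x + - f y) (X \<times> X) a)"
    by (simp only: of_real_sum complex_norm_square cnj_exp_sum exp_sum_mult)
  also have "\<dots> = of_nat (P * card {p \<in> X \<times> X. int P dvd (case p of (x, y) \<Rightarrow> f x + - f y)})"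
    using assms by (intro sum_exp_sum) auto
  also have "{p \<in> X \<times> X. int P dvd (case p of (x, y) \<Rightarrow> f x + - f y)}
      = {(x, y) \<in> X \<times> X. int P dvd f x - f y}"
    by auto
  finally have "complex_of_real (\<Sum>a<P. (norm (exp_sum P f X a))\<^sup>2)
      = of_real (real (P * card {(x, y) \<in> X \<times> X. int P dvd f x - f y}))"
    by (simp only: of_real_of_nat_eq)
  then show ?thesis
    by (rule of_real_eq_iff[THEN iffD1])
qed

section \<open>Counting solutions\<close>

text \<open>The bands between consecutive thresholds are disjoint, so the energies of the
  \<open>J\<close> bands add up to at most the total and cannot all exceed the average.\<close>

lemma energy_pigeonhole:
  fixes F :: "'a \<Rightarrow> real" and \<theta> :: "nat \<Rightarrow> real"
  assumes "finite X" "decseq \<theta>" "J \<ge> 1"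
  shows "\<exists>j<J. (\<Sum>a\<in>{a \<in> X. \<theta> (Suc j) \<le> F a \<and> F a < \<theta> j}. (F a)\<^sup>2) \<le> (\<Sum>a\<in>X. (F a)\<^sup>2) / real J"
proof (rule ccontr)
  define D where "D = (\<lambda>j. {a \<in> X. \<theta> (Suc j) \<le> F a \<and> F a < \<theta> j})"
  define E where "E = (\<Sum>a\<in>X. (F a)\<^sup>2)"
  assume "\<not> ?thesis"
  then have "\<And>j. j < J \<Longrightarrow> E / real J < (\<Sum>a\<in>D j. (F a)\<^sup>2)"
    by (auto simp: D_def E_def not_le)
  then have "(\<Sum>j<J. E / real J) < (\<Sum>j<J. \<Sum>a\<in>D j. (F a)\<^sup>2)"
    using assms(3) by (intro sum_strict_mono) (auto simp: lessThan_empty_iff)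
  also have "\<dots> = (\<Sum>a\<in>(\<Union>j<J. D j). (F a)\<^sup>2)"
  proof (rule sum.UNION_disjoint[symmetric])
    have "D i \<inter> D j = {}" if "i < j" for i j
      using decseqD[OF assms(2), of "Suc i" j] that by (fastforce simp: D_def)
    then show "\<forall>i\<in>{..<J}. \<forall>j\<in>{..<J}. i \<noteq> j \<longrightarrow> D i \<inter> D j = {}"
      by (metis Int_commute nat_neq_iff)
  qed (use assms in \<open>auto simp: D_def\<close>)
  also have "\<dots> \<le> E"
    unfolding E_def using assms(1) by (intro sum_mono2) (auto simp: D_def)
  finally show False
    using assms(3) by simp
qed

lemma dvd_abs_less_imp_zero:
  fixes k m :: int
  assumes "m dvd k" "\<bar>k\<bar> < m"
  shows "k = 0"
  using assms dvd_imp_le_int[of k m] by force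

text \<open>Elements of \<open>A\<close> differ by less than the modulus, so only diagonal pairs
  count: the sum is \<open>4 n\<close> times \<open>card A\<close>.\<close>

lemma parseval_initial_segment_le:
  assumes "n \<ge> 1" "A \<subseteq> {1..int n}"
  shows "(\<Sum>a<4 * n. (norm (exp_sum (4 * n) id A a))\<^sup>2) \<le> 4 * (real n)\<^sup>2"
proof -
  have fin: "finite A"
    using assms(2) finite_subset by blast
  have P: "4 * n \<ge> 1"
    using assms(1) by simp
  have "{(x, y) \<in> A \<times> A. int (4 * n) dvd id x - id y} \<subseteq> (\<lambda>x. (x, x)) ` A"
  proof (rule subrelI)
    fix x y assume "(x, y) \<in> {(x, y) \<in> A \<times> A. int (4 * n) dvd id x - id y}"
    then have xy: "x \<in> A" "y \<in> A" and dvd: "int (4 * n) dvd x - y"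
      by auto
    have "x \<in> {1..int n}" "y \<in> {1..int n}"
      using xy assms(2) by auto
    then have "\<bar>x - y\<bar> < int (4 * n)"
      by (simp add: abs_less_iff)
    with dvd have "x - y = 0"
      by (rule dvd_abs_less_imp_zero)
    with xy show "(x, y) \<in> (\<lambda>x. (x, x)) ` A"
      by simp
  qed
  then have "card {(x, y) \<in> A \<times> A. int (4 * n) dvd id x - id y} \<le> card A"
    using fin by (meson card_image_le card_mono finite_imageI le_trans)
  also have "\<dots> \<le> n"
    using card_mono[OF _ assms(2)] by simp
  finally have "4 * n * card {(x, y) \<in> A \<times> A. int (4 * n) dvd id x - id y} \<le> 4 * n * n"
    by simp
  then have "(\<Sum>a<4 * n. (norm (exp_sum (4 * n) id A a))\<^sup>2) \<le> real (4 * n * n)"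
    unfolding parseval_exp_sum[OF P fin] by (simp only: of_nat_le_iff)
  then show ?thesis
    by (simp add: power2_eq_square)
qed

lemma cos_nonneg_of_near_int:
  assumes "near_int (1 / 4) x"
  shows "cos (2 * pi * x) \<ge> 0"
proof -
  obtain k :: int where k: "\<bar>x - of_int k\<bar> < 1 / 4"
    using assms unfolding near_int_def by blast
  have "cos (2 * pi * x) = cos (2 * pi * (x - of_int k))"
    using cos.plus_of_int[of "2 * pi * (x - of_int k)" k] by (simp add: algebra_simps)
  moreover have "\<bar>2 * pi * (x - of_int k)\<bar> \<le> pi / 2"
    using k mult_left_mono[of "\<bar>x - of_int k\<bar>" "1 / 4" "2 * pi"] by (simp add: abs_mult)
  ultimately show ?thesis
    by (metis cos_ge_zero abs_le_iff minus_le_iff)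
qed

text \<open>Three errors below \<open>1 / 12\<close> add to less than a quarter turn, where the
  cosine is nonnegative; hence every single term has nonnegative real part.\<close>

lemma Re_exp_sum_sum_sq_nonneg:
  assumes "\<And>y. y \<in> G \<Longrightarrow> near_int (1 / 12) (of_int (y\<^sup>2) * (real a / real P))"
  shows "Re (exp_sum P sum_sq (G \<times> G \<times> G) a) \<ge> 0"
proof -
  have "Re (char_mod P (int a * sum_sq w)) \<ge> 0" if "w \<in> G \<times> G \<times> G" for w
  proof -
    from that obtain x y z where w: "w = (x, y, z)" "x \<in> G" "y \<in> G" "z \<in> G"
      by auto
    define \<alpha> where "\<alpha> = real a / real P"
    have "near_int (1 / 12 + (1 / 12 + 1 / 12)) (of_int (x\<^sup>2) * \<alpha> + (of_int (y\<^sup>2) * \<alpha> + of_int (z\<^sup>2) * \<alpha>))"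
      unfolding \<alpha>_def using w by (intro near_int_add assms)
    then have "near_int (1 / 4) (of_int (sum_sq w) * \<alpha>)"
      by (simp add: w algebra_simps)
    then have "cos (2 * pi * (of_int (sum_sq w) * \<alpha>)) \<ge> 0"
      by (rule cos_nonneg_of_near_int)
    then show ?thesis
      by (simp add: char_mod_def \<alpha>_def mult_ac)
  qed
  then show ?thesis
    unfolding exp_sum_def Re_sum by (intro sum_nonneg)
qed

text \<open>Frequencies are split by the size of \<open>F a\<close>: where it is at least \<open>\<sigma> n\<close>, the real part of the
  cubic sum is nonnegative; the frequencies between \<open>\<tau> n\<close> and \<open>\<sigma> n\<close> carry little energy; below
  \<open>\<tau> n\<close> the sixth moment of the square sum applies. The main term comes from \<open>a = 0\<close>.\<close>

lemma card_solutions_ge: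
  fixes A G :: "int set" and n Y :: nat and \<delta> c \<sigma> \<tau> :: real
  assumes "n \<ge> 1" "Y \<ge> 1" "Y\<^sup>2 \<le> n" "n \<le> 4 * Y\<^sup>2"
    and A: "A \<subseteq> {1..int n}" "\<delta> * real n \<le> real (card A)" and "\<delta> > 0"
    and G: "G \<subseteq> {1..int Y}" "c * real Y \<le> real (card G)" and "c > 0"
    and "\<tau> > 0" "320 * \<tau> \<le> c ^ 3 * \<delta>\<^sup>2 / 4"
  defines "F \<equiv> \<lambda>a. norm (exp_sum (4 * n) id A a)"
  assumes large: "\<And>a y. a < 4 * n \<Longrightarrow> \<sigma> * real n \<le> F a \<Longrightarrow> y \<in> G \<Longrightarrow>
      near_int (1 / 12) (of_int (y\<^sup>2) * (real a / real (4 * n)))"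
    and mid: "(\<Sum>a\<in>{a \<in> {..<4 * n}. \<tau> * real n \<le> F a \<and> F a < \<sigma> * real n}. (F a)\<^sup>2) \<le> \<delta>\<^sup>2 * (real n)\<^sup>2 / 4"
  shows "c ^ 3 * \<delta>\<^sup>2 * real Y ^ 3 * real n / 8 \<le>
    real (card {((x1, x2), w) \<in> (A \<times> A) \<times> (G \<times> G \<times> G). x1 - x2 = sum_sq w})"
proof -
  define P where "P = 4 * n"
  define V where "V = G \<times> G \<times> G"
  define U where "U = exp_sum P sum_sq V"
  define b where "b = real (card G)"
  define T where "T = {((x1, x2), w) \<in> (A \<times> A) \<times> V. x1 - x2 = sum_sq w}"
  define Mid where "Mid = {a \<in> {..<P}. \<tau> * real n \<le> F a \<and> F a < \<sigma> * real n}"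
  have P: "P \<ge> 1"
    using assms(1) by (simp add: P_def)
  have fin: "finite A" "finite G" "finite V"
    using A(1) G(1) by (auto simp: V_def intro: finite_subset)
  have cardV: "real (card V) = b ^ 3"
    by (simp add: V_def b_def card_cartesian_product power3_eq_cube)
  have cardA: "card A \<le> n"
    using card_mono[OF _ A(1)] by simp
  have sq_le: "y\<^sup>2 \<le> int n" if "y \<in> {1..int Y}" for y
  proof -
    have "y\<^sup>2 \<le> (int Y)\<^sup>2"
      using that by (intro power_mono) auto
    also have "\<dots> = int (Y\<^sup>2)"
      by simp
    also have "\<dots> \<le> int n"
      using assms(3) by (simp only: of_nat_le_iff)
    finally show ?thesis .
  qed
  have sum_sq_bounds: "0 \<le> sum_sq w" "sum_sq w \<le> 3 * int n" if "w \<in> V" for w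
    using that G(1) sq_le unfolding V_def by (auto simp: subset_iff) (smt (verit, best) sq_le)

  \<comment> \<open>Conjugation puts the minus sign on \<open>x\<close>, so each summand is the real
    part of an exponential sum with phase \<open>- x + y + sum_sq w\<close>, and orthogonality
    counts its zeros modulo \<open>P\<close>.\<close>
  have count: "(\<Sum>a<P. (F a)\<^sup>2 * Re (U a)) = real P * real (card T)"
  proof -
    define f where "f = (\<lambda>((x, y), w). (- x + y) + sum_sq w)"
    define W where "W = {v \<in> (A \<times> A) \<times> V. int P dvd f v}"
    have "of_real ((F a)\<^sup>2) * U a = exp_sum P f ((A \<times> A) \<times> V) a" for a
    proof -
      have "of_real ((F a)\<^sup>2) = exp_sum P (\<lambda>x. - x) A a * exp_sum P (\<lambda>x. x) A a"
        unfolding F_def complex_norm_square cnj_exp_sum by (simp add: P_def id_def mult.commute)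
      then show ?thesis
        unfolding U_def by (simp add: exp_sum_mult f_def case_prod_unfold)
    qed
    then have "(\<Sum>a<P. of_real ((F a)\<^sup>2) * U a) = (\<Sum>a<P. exp_sum P f ((A \<times> A) \<times> V) a)"
      by (simp only:)
    also have "\<dots> = of_nat (P * card W)"
      unfolding W_def using fin by (intro sum_exp_sum[OF P]) auto
    finally have "(\<Sum>a<P. of_real ((F a)\<^sup>2) * U a) = of_nat (P * card W)" .
    moreover have "W = T"
    proof -
      have "int P dvd (- x + y) + sum_sq w \<longleftrightarrow> x - y = sum_sq w" if "x \<in> A" "y \<in> A" "w \<in> V" for x y w
      proof
        assume dvd: "int P dvd (- x + y) + sum_sq w"
        have "x \<in> {1..int n}" "y \<in> {1..int n}"
          using that A(1) by auto
        \<comment> \<open>The difference lies strictly between \<open>- n\<close> and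
          \<open>n\<close> and \<open>sum_sq w\<close> between \<open>0\<close> and
          \<open>3 n\<close>; this is what the modulus \<open>4 n\<close> is for.\<close>
        then have "\<bar>(- x + y) + sum_sq w\<bar> < int P"
          using sum_sq_bounds[OF that(3)] by (simp add: P_def abs_less_iff)
        with dvd have "(- x + y) + sum_sq w = 0"
          by (rule dvd_abs_less_imp_zero)
        then show "x - y = sum_sq w"
          by simp
      next
        assume "x - y = sum_sq w"
        then have "(- x + y) + sum_sq w = 0"
          by simp
        then show "int P dvd (- x + y) + sum_sq w"
          by (simp only: dvd_0_right)
      qed
      then show ?thesis
        by (auto simp: W_def T_def f_def)
    qed
    ultimately have "Re (\<Sum>a<P. of_real ((F a)\<^sup>2) * U a) = real (P * card T)"
      by simp
    then show ?thesis
      by (simp add: Re_sum)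
  qed

  have parseval: "(\<Sum>a<P. (F a)\<^sup>2) \<le> 4 * (real n)\<^sup>2"
    unfolding F_def P_def by (rule parseval_initial_segment_le[OF assms(1) A(1)])

  have sixth_moment: "(\<Sum>a<P. (norm (U a))\<^sup>2) \<le> 6144 * real n * real Y ^ 4"
  proof -
    define X where "X = {1..int Y} \<times> {1..int Y} \<times> {1..int Y}"
    have "{(s, t) \<in> V \<times> V. int P dvd sum_sq s - sum_sq t} \<subseteq> {(s, t) \<in> X \<times> X. sum_sq s = sum_sq t}"
    proof (rule subrelI)
      fix s t assume st: "(s, t) \<in> {(s, t) \<in> V \<times> V. int P dvd sum_sq s - sum_sq t}"
      then have "\<bar>sum_sq s - sum_sq t\<bar> < int P"
        using sum_sq_bounds[of s] sum_sq_bounds[of t] assms(1) by (auto simp: P_def)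
      with st have "sum_sq s - sum_sq t = 0"
        using dvd_abs_less_imp_zero[of "int P" "sum_sq s - sum_sq t"] by simp
      with st G(1) show "(s, t) \<in> {(s, t) \<in> X \<times> X. sum_sq s = sum_sq t}"
        by (auto simp: V_def X_def)
    qed
    moreover have "finite {(s, t) \<in> X \<times> X. sum_sq s = sum_sq t}"
      by (rule finite_subset[of _ "X \<times> X"]) (auto simp: X_def)
    ultimately have "real (card {(s, t) \<in> V \<times> V. int P dvd sum_sq s - sum_sq t})
        \<le> real (card {(s, t) \<in> X \<times> X. sum_sq s = sum_sq t})"
      by (intro of_nat_mono card_mono)
    also have "\<dots> \<le> 1536 * real Y ^ 4"
      using card_sum_sq_eq_le[of "int Y"] assms(2) by (simp add: X_def)
    finally have "real P * real (card {(s, t) \<in> V \<times> V. int P dvd sum_sq s - sum_sq t})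
        \<le> real P * (1536 * real Y ^ 4)"
      by (intro mult_left_mono) auto
    then show ?thesis
      unfolding U_def parseval_exp_sum[OF P fin(3)] by (simp add: P_def)
  qed

  have minor: "(\<Sum>a<P. F a * norm (U a)) \<le> 320 * real n * real Y ^ 3"
  proof (rule power2_le_imp_le)
    have n: "real n \<le> 4 * (real Y)\<^sup>2"
      using assms(4) by (metis of_nat_le_iff of_nat_mult of_nat_numeral of_nat_power)
    have "(\<Sum>a<P. F a * norm (U a))\<^sup>2 \<le> (\<Sum>a<P. (F a)\<^sup>2) * (\<Sum>a<P. (norm (U a))\<^sup>2)"
      by (rule Cauchy_Schwarz_ineq_sum)
    also have "\<dots> \<le> (4 * (real n)\<^sup>2) * (6144 * real n * real Y ^ 4)"
      by (intro mult_mono parseval sixth_moment sum_nonneg) auto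
    also have "\<dots> = (24576 * (real n)\<^sup>2 * real Y ^ 4) * real n"
      by (simp add: algebra_simps)
    also have "\<dots> \<le> (24576 * (real n)\<^sup>2 * real Y ^ 4) * (4 * (real Y)\<^sup>2)"
      by (intro mult_left_mono n) auto
    also have "\<dots> = 98304 * ((real n)\<^sup>2 * real Y ^ 6)"
      by (simp add: mult_ac flip: power_add)
    \<comment> \<open>Rounding up to a perfect square, \<open>102400 = 320^2\<close>.\<close>
    also have "\<dots> \<le> 102400 * ((real n)\<^sup>2 * real Y ^ 6)"
      by (intro mult_right_mono) auto
    also have "\<dots> = (320 * real n * real Y ^ 3)\<^sup>2"
      by (simp add: power_mult_distrib flip: power_mult)
    finally show "(\<Sum>a<P. F a * norm (U a))\<^sup>2 \<le> (320 * real n * real Y ^ 3)\<^sup>2" .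
  qed simp

  \<comment> \<open>Both error terms are nonnegative, so they may be subtracted at every frequency;
    this yields one inequality for all cases that can be summed.\<close>
  have pointwise: "of_bool (a = 0) * ((real (card A))\<^sup>2 * b ^ 3) - of_bool (a \<in> Mid) * ((F a)\<^sup>2 * b ^ 3)
      - \<tau> * real n * (F a * norm (U a)) \<le> (F a)\<^sup>2 * Re (U a)" if a: "a < P" for a
  proof -
    have F0: "F a \<ge> 0"
      by (simp add: F_def)
    have nonneg: "\<tau> * real n * (F a * norm (U a)) \<ge> 0" "(F a)\<^sup>2 * b ^ 3 \<ge> 0"
      using assms(11) F0 by (auto simp: b_def)
    have Ub: "norm (U a) \<le> b ^ 3"
      using norm_exp_sum_le[of P sum_sq V a] by (simp add: U_def cardV)
    have ReU: "- norm (U a) \<le> Re (U a)"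
      using abs_Re_le_cmod[of "U a"] by linarith
    consider "a = 0" | "a \<noteq> 0" "\<sigma> * real n \<le> F a" | "a \<noteq> 0" "a \<in> Mid"
      | "a \<noteq> 0" "F a \<le> \<tau> * real n" "a \<notin> Mid"
      using a by (auto simp: Mid_def) linarith+
    then show ?thesis
    proof cases
      case 1
      then have "(F a)\<^sup>2 * Re (U a) = (real (card A))\<^sup>2 * b ^ 3"
        by (simp add: F_def U_def cardV)
      with 1 nonneg show ?thesis
        by (cases "a \<in> Mid") (auto simp del: power_eq_0_iff)
    next
      case 2
      then have "Re (U a) \<ge> 0"
        unfolding U_def V_def using large a by (intro Re_exp_sum_sum_sq_nonneg) (simp add: P_def)
      then have "(F a)\<^sup>2 * Re (U a) \<ge> 0"
        by simp
      moreover have "of_bool (a \<in> Mid) * ((F a)\<^sup>2 * b ^ 3) \<ge> 0"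
        using nonneg(2) by (auto simp: of_bool_def)
      ultimately show ?thesis
        using nonneg 2(1) by simp
    next
      case 3
      have "(F a)\<^sup>2 * (- (b ^ 3)) \<le> (F a)\<^sup>2 * Re (U a)"
        using Ub ReU by (intro mult_left_mono) auto
      with 3 nonneg show ?thesis
        by simp
    next
      case 4
      have "F a * (F a * norm (U a)) \<le> \<tau> * real n * (F a * norm (U a))"
        using 4 F0 by (intro mult_right_mono) auto
      moreover have "(F a)\<^sup>2 * (- norm (U a)) \<le> (F a)\<^sup>2 * Re (U a)"
        using ReU by (intro mult_left_mono) auto
      ultimately show ?thesis
        using 4 by (simp add: power2_eq_square mult.assoc)
    qed
  qed
  have b: "b \<ge> 0" "c ^ 3 * real Y ^ 3 \<le> b ^ 3"
    using power_mono[OF G(2), of 3] \<open>c > 0\<close> by (auto simp: b_def power_mult_distrib)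
  have "(real (card A))\<^sup>2 * b ^ 3 - (\<Sum>a\<in>Mid. (F a)\<^sup>2) * b ^ 3 - \<tau> * real n * (\<Sum>a<P. F a * norm (U a))
      = (\<Sum>a<P. of_bool (a = 0) * ((real (card A))\<^sup>2 * b ^ 3) - of_bool (a \<in> Mid) * ((F a)\<^sup>2 * b ^ 3)
      - \<tau> * real n * (F a * norm (U a)))"
  proof -
    have "(\<Sum>a<P. of_bool (a = 0) * ((real (card A))\<^sup>2 * b ^ 3)) = (\<Sum>a\<in>{0::nat}. (real (card A))\<^sup>2 * b ^ 3)"
      by (rule sum.mono_neutral_cong_right) (use P in auto)
    moreover have "(\<Sum>a<P. of_bool (a \<in> Mid) * ((F a)\<^sup>2 * b ^ 3)) = (\<Sum>a\<in>Mid. (F a)\<^sup>2 * b ^ 3)"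
      by (intro sum.mono_neutral_cong_right) (auto simp: Mid_def)
    ultimately show ?thesis
      by (simp add: sum_subtractf sum_distrib_left sum_distrib_right)
  qed
  also have "\<dots> \<le> real P * real (card T)"
    unfolding count[symmetric] using pointwise by (intro sum_mono) auto
  finally have lower: "(real (card A))\<^sup>2 * b ^ 3 - (\<Sum>a\<in>Mid. (F a)\<^sup>2) * b ^ 3
      - \<tau> * real n * (\<Sum>a<P. F a * norm (U a)) \<le> real P * real (card T)" .
  have "(\<delta> * real n)\<^sup>2 * b ^ 3 \<le> (real (card A))\<^sup>2 * b ^ 3"
    using A(2) \<open>\<delta> > 0\<close> b by (intro mult_right_mono power_mono) auto
  moreover have "(\<Sum>a\<in>Mid. (F a)\<^sup>2) * b ^ 3 \<le> (\<delta>\<^sup>2 * (real n)\<^sup>2 / 4) * b ^ 3"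
    using mid b by (intro mult_right_mono) (auto simp: Mid_def P_def)
  moreover have "\<tau> * real n * (\<Sum>a<P. F a * norm (U a)) \<le> (c ^ 3 * \<delta>\<^sup>2 / 4) * ((real n)\<^sup>2 * real Y ^ 3)"
  proof -
    have "\<tau> * real n * (\<Sum>a<P. F a * norm (U a)) \<le> \<tau> * real n * (320 * real n * real Y ^ 3)"
      using assms(11) by (intro mult_left_mono minor) auto
    also have "\<dots> = 320 * \<tau> * ((real n)\<^sup>2 * real Y ^ 3)"
      by (simp add: power2_eq_square mult_ac)
    also have "\<dots> \<le> (c ^ 3 * \<delta>\<^sup>2 / 4) * ((real n)\<^sup>2 * real Y ^ 3)"
      using assms(12) by (intro mult_right_mono) auto
    finally show ?thesis .
  qed
  \<comment> \<open>The middle range leaves \<open>3 / 4\<close> of the main term. Replacing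
    \<open>b\<close> by \<open>c * Y\<close> there and subtracting the small-frequency error leaves
    one half, and dividing by \<open>P = 4 * n\<close> gives the factor
    \<open>1 / 8\<close>.\<close>
  moreover have "(3 / 4 * \<delta>\<^sup>2 * (real n)\<^sup>2) * (c ^ 3 * real Y ^ 3) \<le> (3 / 4 * \<delta>\<^sup>2 * (real n)\<^sup>2) * b ^ 3"
    using b by (intro mult_left_mono) auto
  ultimately have "c ^ 3 * \<delta>\<^sup>2 * (real n)\<^sup>2 * real Y ^ 3 / 2 \<le> real P * real (card T)"
    using lower by (simp add: power_mult_distrib algebra_simps)
  then have "real n * (c ^ 3 * \<delta>\<^sup>2 * real Y ^ 3 * real n / 8) \<le> real n * real (card T)"
    by (simp add: P_def power2_eq_square mult_ac)
  then show ?thesis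
    using assms(1) by (simp add: T_def V_def)
qed

section \<open>Choice of thresholds and constants, and conclusion\<close>

theorem theorem2p4:
  fixes \<delta> :: real and M :: nat
  assumes "\<delta> > 0" and "M \<ge> 1"
  shows "\<exists>N0 c0 :: real. c0 > 0 \<and>
    (\<forall>N :: real. N \<ge> N0 \<longrightarrow>
      (\<forall>A B :: int set.
        A \<subseteq> initial_segment N \<longrightarrow> real (card A) \<ge> \<delta> * N \<longrightarrow> homogeneous M B \<longrightarrow>
        real (card {(x1, x2, y1, y2, y3). x1 \<in> A \<and> x2 \<in> A \<and> y1 \<in> B \<and> y2 \<in> B \<and> y3 \<in> B \<and>
            x1 - x2 = y1\<^sup>2 + y2\<^sup>2 + y3\<^sup>2})
          \<ge> c0 * N powr (5 / 2)))"
proof -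
  define good where "good = (\<lambda>B S Y.
    {y \<in> B. y \<le> int Y \<and> (\<forall>\<alpha>\<in>S. near_int (1 / 12) (of_int (y\<^sup>2) * \<alpha>))})"
  have "\<forall>K. \<exists>L\<ge>1. \<forall>B S Y. homogeneous M B \<longrightarrow> finite S \<longrightarrow> card S \<le> K \<longrightarrow> Y div L \<le> L * card (good B S Y)"
    unfolding good_def using homogeneous_recurrence[OF \<open>M \<ge> 1\<close>] by blast
  then obtain Lf where Lf: "\<And>K. Lf K \<ge> (1 :: nat)"
      "\<And>K B S Y. homogeneous M B \<Longrightarrow> finite S \<Longrightarrow> card S \<le> K \<Longrightarrow> Y div Lf K \<le> Lf K * card (good B S Y)"
    by metis
  \<comment> \<open>By Parseval at most \<open>4 / \<epsilon>^2\<close> frequencies have a transform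
    of size at least \<open>\<epsilon> n\<close>.\<close>
  define L where "L = (\<lambda>\<epsilon> :: real. Lf (nat \<lceil>4 / \<epsilon>\<^sup>2\<rceil>))"
  \<comment> \<open>This is the density of \<open>G\<close>: one factor \<open>L\<close> comes from
    \<open>Y div L\<close>, one from the multiplicity of its elements, and the 2 from rounding the
    quotient.\<close>
  define c where "c = (\<lambda>\<epsilon>. 1 / (2 * (real (L \<epsilon>))\<^sup>2))"
  \<comment> \<open>With \<open>1280 = 4 * 320\<close> the next threshold is small enough for the
    small-frequency bound in \<open>card_solutions_ge\<close>; the minimum keeps the thresholds
    decreasing. They depend on \<open>\<delta>\<close> and \<open>M\<close> only.\<close>
  define step where "step = (\<lambda>\<epsilon>. min \<epsilon> (c \<epsilon> ^ 3 * \<delta>\<^sup>2 / 1280))"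
  define \<epsilon> where "\<epsilon> = (\<lambda>j. (step ^^ j) 1)"
  have L1: "L e \<ge> 1" and c_pos: "c e > 0" for e
    using Lf(1) by (auto simp: L_def c_def Suc_le_eq)
  have eps_Suc: "\<epsilon> (Suc j) = min (\<epsilon> j) (c (\<epsilon> j) ^ 3 * \<delta>\<^sup>2 / 1280)" for j
    by (simp add: \<epsilon>_def step_def)
  have eps_pos: "\<epsilon> j > 0" for j
  proof (induction j)
    case (Suc j)
    with c_pos \<open>\<delta> > 0\<close> show ?case
      by (simp add: eps_Suc)
  qed (simp add: \<epsilon>_def)
  \<comment> \<open>A share \<open>1 / J\<close> of the energy \<open>4 n^2\<close> is then at most
    \<open>\<delta>^2 n^2 / 4\<close>, the loss allowed in the middle range.\<close>
  define J where "J = nat \<lceil>16 / \<delta>\<^sup>2\<rceil>"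
  have J: "real J \<ge> 16 / \<delta>\<^sup>2" "J \<ge> 1"
    using \<open>\<delta> > 0\<close> by (auto simp: J_def Suc_le_eq)
  \<comment> \<open>The good index \<open>j\<close> depends on \<open>A\<close>; the sum bounds all
    \<open>L (\<epsilon> j)\<close> with \<open>j < J\<close> at once and so makes the constants
    uniform.\<close>
  define Lmax where "Lmax = (\<Sum>j<J. L (\<epsilon> j))"
  have L_le: "L (\<epsilon> j) \<le> Lmax" if "j < J" for j
    unfolding Lmax_def using that by (intro member_le_sum) auto
  have Lmax: "Lmax \<ge> 1"
    using L_le[of 0] L1[of "\<epsilon> 0"] J(2) by linarith
  define c1 where "c1 = 1 / (2 * (real Lmax)\<^sup>2)"
  have c1: "c1 > 0"
    using Lmax by (simp add: c1_def)
  have c1_le: "c1 \<le> c (\<epsilon> j)" if "j < J" for j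
    using L_le[OF that] L1[of "\<epsilon> j"] unfolding c1_def c_def
    by (intro divide_left_mono mult_left_mono power_mono) auto
  \<comment> \<open>Here \<open>128 = 8 * 2^3 * 2\<close>, from the counting bound,
    \<open>Y \<ge> sqrt N / 2\<close> and \<open>n \<ge> N / 2\<close>.\<close>
  define c0 where "c0 = c1 ^ 3 * \<delta>\<^sup>2 / 128"
  have "c0 * N powr (5 / 2) \<le> real (card {(x1, x2, y1, y2, y3). x1 \<in> A \<and> x2 \<in> A \<and> y1 \<in> B \<and> y2 \<in> B \<and>
      y3 \<in> B \<and> x1 - x2 = y1\<^sup>2 + y2\<^sup>2 + y3\<^sup>2})"
    if N: "N \<ge> 4 * (real Lmax)\<^sup>2" and A: "A \<subseteq> initial_segment N" "real (card A) \<ge> \<delta> * N"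
      and B: "homogeneous M B" for N A B
  proof -
    define n where "n = nat \<lfloor>N\<rfloor>"
    define Y where "Y = nat \<lfloor>sqrt N\<rfloor>"
    have sqrtN: "sqrt N \<ge> 2 * real Lmax"
      using N by (intro real_le_rsqrt) (simp add: power_mult_distrib)
    have "4 * 1 \<le> 4 * (real Lmax)\<^sup>2"
      using Lmax by (intro mult_left_mono) auto
    with N have N4: "N \<ge> 4"
      by linarith
    have sq: "sqrt N * sqrt N = N"
      using N4 by simp
    have Y: "real Y \<le> sqrt N" "sqrt N < real Y + 1"
      using N4 by (auto simp: Y_def)
    have Y2: "sqrt N \<le> 2 * real Y"
      using Y(2) sqrtN Lmax by simp
    have n: "real n \<le> N" "N / 2 \<le> real n" "n \<ge> 1"
      using N4 unfolding n_def by linarith+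
    have Ln: "Lmax \<le> Y"
      using Y2 sqrtN by simp
    have Y1: "Y \<ge> 1"
      using Ln Lmax by linarith
    have "real (Y\<^sup>2) \<le> N"
      using mult_mono[OF Y(1) Y(1)] N4 by (simp add: power2_eq_square)
    then have Y_sq: "Y\<^sup>2 \<le> n"
      unfolding n_def by (rule le_nat_floor)
    have "real n \<le> real (4 * Y\<^sup>2)"
      using mult_mono[OF Y2 Y2] n(1) N4 by (simp add: power2_eq_square)
    then have n_le: "n \<le> 4 * Y\<^sup>2"
      by (simp only: of_nat_le_iff)
    have A': "A \<subseteq> {1..int n}"
      using A(1) N4 by (simp add: initial_segment_def n_def)
    have finA: "finite A"
      using A' finite_subset by blast
    have cardA: "card A \<le> n"
      using card_mono[OF _ A'] by simp
    have densA: "\<delta> * real n \<le> real (card A)"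
      using A(2) mult_left_mono[OF n(1), of \<delta>] \<open>\<delta> > 0\<close> by linarith
    define F where "F = (\<lambda>a. norm (exp_sum (4 * n) id A a))"
    have energy: "(\<Sum>a<4 * n. (F a)\<^sup>2) \<le> 4 * (real n)\<^sup>2"
      unfolding F_def by (rule parseval_initial_segment_le[OF n(3) A'])
    have "decseq (\<lambda>j. \<epsilon> j * real n)"
      by (intro decseq_SucI mult_right_mono) (auto simp: eps_Suc)
    from energy_pigeonhole[OF finite_lessThan[of "4 * n"] this J(2), of F] obtain j where j: "j < J" and
      "(\<Sum>a\<in>{a \<in> {..<4 * n}. \<epsilon> (Suc j) * real n \<le> F a \<and> F a < \<epsilon> j * real n}. (F a)\<^sup>2)
        \<le> (\<Sum>a<4 * n. (F a)\<^sup>2) / real J"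
      by blast
    note this(2)
    also have "(\<Sum>a<4 * n. (F a)\<^sup>2) / real J \<le> 4 * (real n)\<^sup>2 / (16 / \<delta>\<^sup>2)"
      using energy J \<open>\<delta> > 0\<close> by (intro frac_le) auto
    finally have mid: "(\<Sum>a\<in>{a \<in> {..<4 * n}. \<epsilon> (Suc j) * real n \<le> F a \<and> F a < \<epsilon> j * real n}. (F a)\<^sup>2)
        \<le> \<delta>\<^sup>2 * (real n)\<^sup>2 / 4"
      by (simp add: mult_ac)
    define Spec where "Spec = {a \<in> {..<4 * n}. \<epsilon> j * real n \<le> F a}"
    have "card Spec \<le> nat \<lceil>4 / (\<epsilon> j)\<^sup>2\<rceil>"
    proof -
      have "real (card Spec) * (\<epsilon> j * real n)\<^sup>2 = (\<Sum>a\<in>Spec. (\<epsilon> j * real n)\<^sup>2)"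
        by simp
      also have "\<dots> \<le> (\<Sum>a\<in>Spec. (F a)\<^sup>2)"
        using eps_pos[of j] by (intro sum_mono power_mono) (auto simp: Spec_def)
      also have "\<dots> \<le> (\<Sum>a<4 * n. (F a)\<^sup>2)"
        by (intro sum_mono2) (auto simp: Spec_def)
      also have "\<dots> \<le> 4 * (real n)\<^sup>2"
        by (rule energy)
      finally have "real (card Spec) \<le> 4 / (\<epsilon> j)\<^sup>2"
        using n(3) eps_pos[of j] by (simp add: power_mult_distrib field_simps)
      then show ?thesis
        by linarith
    qed
    moreover define S where "S = (\<lambda>a. real a / real (4 * n)) ` Spec"
    moreover have "finite Spec"
      by (simp add: Spec_def)
    ultimately have S: "finite S" "card S \<le> nat \<lceil>4 / (\<epsilon> j)\<^sup>2\<rceil>"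
      using card_image_le[of Spec "\<lambda>a. real a / real (4 * n)"] by (auto simp del: of_nat_mult)
    define G where "G = good B S Y"
    have G_sub: "G \<subseteq> {1..int Y}" "G \<subseteq> B"
      using B by (auto simp: G_def good_def homogeneous_def)
    define l where "l = L (\<epsilon> j)"
    have l: "1 \<le> l" "l \<le> Y"
      using L1 L_le[OF j] Ln by (auto simp: l_def intro: order_trans)
    have "Y div l \<le> l * card G"
      using Lf(2)[OF B S] by (simp add: G_def l_def L_def)
    then have "2 * l * (Y div l) \<le> 2 * l * (l * card G)"
      by (intro mult_left_mono) auto
    \<comment> \<open>Since \<open>l \<le> Y\<close>, the quotient is at least 1, so the remainder
      is below \<open>l * (Y div l)\<close>.\<close>
    moreover have "Y \<le> 2 * l * (Y div l)"
    proof -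
      have "l * 1 \<le> l * (Y div l)"
        using l by (intro mult_left_mono) (auto simp: Suc_le_eq div_greater_zero_iff)
      moreover have "Y mod l < l" "l * (Y div l) + Y mod l = Y"
        using l by auto
      ultimately show ?thesis
        by (simp only: mult.assoc)
    qed
    ultimately have "Y \<le> 2 * l * (l * card G)"
      by (rule order_trans[rotated])
    then have "Y \<le> 2 * l\<^sup>2 * card G"
      by (simp only: power2_eq_square mult.assoc)
    then have "real Y \<le> real (2 * l\<^sup>2 * card G)"
      by (simp only: of_nat_le_iff)
    then have card_G: "c (\<epsilon> j) * real Y \<le> real (card G)"
      using l by (simp add: c_def field_simps flip: l_def)
    have "1280 * \<epsilon> (Suc j) \<le> c (\<epsilon> j) ^ 3 * \<delta>\<^sup>2"
      by (simp add: eps_Suc)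
    then have tau: "320 * \<epsilon> (Suc j) \<le> c (\<epsilon> j) ^ 3 * \<delta>\<^sup>2 / 4"
      by simp
    have large: "near_int (1 / 12) (of_int (y\<^sup>2) * (real a / real (4 * n)))"
      if "a < 4 * n" "\<epsilon> j * real n \<le> F a" "y \<in> G" for a y
      using that unfolding G_def good_def S_def Spec_def by blast
    have "c (\<epsilon> j) ^ 3 * \<delta>\<^sup>2 * real Y ^ 3 * real n / 8 \<le>
        real (card {((x1, x2), w) \<in> (A \<times> A) \<times> (G \<times> G \<times> G). x1 - x2 = sum_sq w})"
      using card_solutions_ge[OF n(3) Y1 Y_sq n_le A' densA \<open>\<delta> > 0\<close> G_sub(1) card_G c_pos eps_pos tau,
          of "\<epsilon> j"] large mid unfolding F_def by blast
    also have "\<dots> \<le> real (card {(x1, x2, y1, y2, y3). x1 \<in> A \<and> x2 \<in> A \<and> y1 \<in> B \<and> y2 \<in> B \<and>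
      y3 \<in> B \<and> x1 - x2 = y1\<^sup>2 + y2\<^sup>2 + y3\<^sup>2})" (is "_ \<le> real (card ?R)")
    proof (intro of_nat_mono card_inj_on_le[where f = "\<lambda>((x1, x2), (y1, y2, y3)). (x1, x2, y1, y2, y3)"])
      \<comment> \<open>An infinite set would have \<open>card\<close> equal to 0. Finiteness holds
        because each \<open>y\<close> is at most its square, which is bounded by
        \<open>x1 - x2\<close>.\<close>
      show "finite ?R"
      proof (rule finite_subset)
        have "y1 \<in> {1..int n} \<and> y2 \<in> {1..int n} \<and> y3 \<in> {1..int n}"
          if "x1 \<in> A" "x2 \<in> A" "y1 \<in> B" "y2 \<in> B" "y3 \<in> B" "x1 - x2 = y1\<^sup>2 + y2\<^sup>2 + y3\<^sup>2" for x1 x2 y1 y2 y3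
        proof -
          have "y1 \<ge> 1" "y2 \<ge> 1" "y3 \<ge> 1"
            using that B by (auto simp: homogeneous_def subset_iff int_one_le_iff_zero_less)
          moreover from this have "y1 \<le> y1\<^sup>2" "y2 \<le> y2\<^sup>2" "y3 \<le> y3\<^sup>2"
            by (auto intro: self_le_power)
          moreover have "x1 \<le> int n" "1 \<le> x2"
            using that A' by auto
          ultimately show ?thesis
            using that(6) by auto
        qed
        then show "?R \<subseteq> A \<times> A \<times> {1..int n} \<times> {1..int n} \<times> {1..int n}"
          by blast
      qed (use finA in auto)
    qed (use G_sub(2) in \<open>auto simp: inj_on_def\<close>)
    finally have main: "c (\<epsilon> j) ^ 3 * \<delta>\<^sup>2 * real Y ^ 3 * real n / 8 \<le> real (card ?R)" .
    have "N powr (5 / 2) = N * N * sqrt N"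
    proof -
      have "N powr (5 / 2) = N powr (2 + 1 / 2)"
        by simp
      also have "\<dots> = N powr 2 * N powr (1 / 2)"
        by (rule powr_add)
      finally show ?thesis
        using N4 by (simp add: powr_half_sqrt power2_eq_square)
    qed
    then have "c0 * N powr (5 / 2) = c1 ^ 3 * \<delta>\<^sup>2 * (sqrt N / 2) ^ 3 * (N / 2) / 8"
      using sq by (simp add: c0_def power3_eq_cube algebra_simps)
    also have "\<dots> \<le> c (\<epsilon> j) ^ 3 * \<delta>\<^sup>2 * real Y ^ 3 * real n / 8"
      using \<open>\<delta> > 0\<close> c1_le[OF j] c1 c_pos[of "\<epsilon> j"] Y2 n N4
      by (intro divide_right_mono mult_mono power_mono) auto
    finally show ?thesis
      using main by linarith
  qed
  moreover have "c0 > 0"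
    using c1 \<open>\<delta> > 0\<close> by (simp add: c0_def)
  ultimately show ?thesis
    by blast
qed

end
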